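(* Let $n\ge 2$ and let $f(\mathbf z,\bar{\mathbf z})$ be a mixed function of $n$ complex variables $\mathbf z=(z_1,\dots,z_n)$ with $f(\mathbf 0)=0$ and with a singularity at the origin. Assume that $f$ satisfies the Hamm–Lê condition at the origin and let $r_0>0$ be a stable Milnor radius for $f$. Assume that there exists a mixed smooth point $\mathbf w\in f^{-1}(0)$ with $\|\mathbf w\|<r_0$ such that the sphere $S^{2n-1}_{\|\mathbf w\|}$ of radius $\|\mathbf w\|$ intersects $f^{-1}(0)$ transversely at $\mathbf w$. Assume also that $\dim_{\mathbb R} f^{-1}(0)=2n-2$. Then the Milnor fiber of $f$ at the origin is connected.
   Context: A mixed function of $n$ complex variables is a complex-valued function given near $\mathbf 0\in\mathbb C^n$ by a convergent power series $f(\mathbf z,\bar{\mathbf z})=\sum_{\nu,\mu}c_{\nu,\mu}\mathbf z^{\nu}\bar{\mathbf z}^{\mu}$ in $z_1,\dots,z_n,\bar z_1,\dots,\bar z_n$ with $c_{\nu,\mu}\in\mathbb C$, where $\nu,\mu$ are multi-indices; it is a mixed polynomial if the sum is finite. All balls considered are contained in the domain of $f$. A point $\mathbf p$ is a mixed smooth point of $f^{-1}(0)$ if $f(\mathbf p)=0$ and the real differential of $f$ at $\mathbf p$, viewed as a map $\mathbb R^{2n}\to\mathbb R^2$, is surjective. More generally, a point is a critical (mixed singular) point of $f$ if the real differential there is not surjective; "$f$ has a singularity at the origin" means that the origin is such a point. Put $B_r^{2n}=\{\mathbf z\in\mathbb C^n : \|\mathbf z\|\le r\}$ and $S_r^{2n-1}=\partial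 B_r^{2n}$. Hamm–Lê condition at the origin: there exists $r_0>0$ such that for every $r_1$ with $0<r_1\le r_0$ there exists $\delta(r_1)>0$ such that for all $r,\eta$ with $r_1\le r\le r_0$ and $\eta\in\mathbb C$, $0\ne|\eta|\le\delta(r_1)$, the hypersurface $f^{-1}(\eta)\cap B_{r_0}^{2n}$ is non-empty, non-singular, and intersects the sphere $S_r^{2n-1}$ transversely. Such an $r_0$ is called a stable Milnor radius. Milnor fiber at the origin: for $0<r_1\le r\le r_0$ and $0<\delta\le\delta(r_1)$, it is $f^{-1}(\delta)\cap B_r^{2n}$, the fiber of the tubular Milnor fibration $f:\{\mathbf z\in B_r^{2n} : 0<|f(\mathbf z,\bar{\mathbf z})|\le\delta\}\to\{\zeta\in\mathbb C : 0<|\zeta|\le\delta\}$. Under the Hamm–Lê condition this is a locally trivial fibration whose isomorphism class does not depend on the choice of $r$ and $\delta$. *)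

theory Defs
  imports "HOL-Analysis.Analysis"
begin

text \<open>
  The space \<open>complex ^ 'n\<close> is used as the real Euclidean space of dimension \<open>2 * CARD('n)\<close>:
  its norm is the Hermitian norm, its inner product is the real part of the Hermitian product,
  and \<open>frechet_derivative\<close> is the real differential. Functions are total in HOL, so the domain
  \<open>U\<close> of a mixed function is carried along explicitly.
\<close>

definition mixed_function :: "(complex ^ 'n) set \<Rightarrow> (complex ^ 'n \<Rightarrow> complex) \<Rightarrow> bool" where
  "mixed_function U f \<longleftrightarrow> open U \<and> 0 \<in> U \<and>
     (\<exists>c :: ('n \<Rightarrow> nat) \<Rightarrow> ('n \<Rightarrow> nat) \<Rightarrow> complex. \<forall>z\<in>U.
        ((\<lambda>(\<nu>, \<mu>). c \<nu> \<mu> * (\<Prod>i\<in>UNIV. (z $ i) ^ \<nu> i) * (\<Prod>i\<in>UNIV. (cnj (z $ i)) ^ \<mu> i))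
           has_sum f z) UNIV)"

definition mixed_critical :: "(complex ^ 'n \<Rightarrow> complex) \<Rightarrow> complex ^ 'n \<Rightarrow> bool" where
  "mixed_critical f p \<longleftrightarrow> \<not> surj (frechet_derivative f (at p))"

definition mixed_smooth_zero ::
    "(complex ^ 'n) set \<Rightarrow> (complex ^ 'n \<Rightarrow> complex) \<Rightarrow> complex ^ 'n \<Rightarrow> bool" where
  "mixed_smooth_zero U f p \<longleftrightarrow> p \<in> U \<and> f p = 0 \<and> \<not> mixed_critical f p"

text \<open>
  Tangent spaces at \<open>p\<close>, as real linear subspaces: of the fibre of \<open>f\<close> through \<open>p\<close> (meaningful when
  \<open>p\<close> is not critical), and of the sphere around the origin through \<open>p\<close> (meaningful when \<open>p \<noteq> 0\<close>).
\<close>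

definition fiber_tangent :: "(complex ^ 'n \<Rightarrow> complex) \<Rightarrow> complex ^ 'n \<Rightarrow> (complex ^ 'n) set" where
  "fiber_tangent f p = {v. frechet_derivative f (at p) v = 0}"

definition sphere_tangent :: "complex ^ 'n \<Rightarrow> (complex ^ 'n) set" where
  "sphere_tangent p = {v. p \<bullet> v = 0}"

definition transverse_to_sphere_at :: "(complex ^ 'n \<Rightarrow> complex) \<Rightarrow> complex ^ 'n \<Rightarrow> bool" where
  "transverse_to_sphere_at f p \<longleftrightarrow>
     {u + v | u v. u \<in> fiber_tangent f p \<and> v \<in> sphere_tangent p} = UNIV"

text \<open>
  \<open>hamm_le_bound f r\<^sub>0 r\<^sub>1 d\<close> says that \<open>d\<close> is an admissible choice of the number
  \<open>\<delta>(r\<^sub>1)\<close> in the Hamm-Le condition for the radius \<open>r\<^sub>0\<close>.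
\<close>

definition hamm_le_bound :: "(complex ^ 'n \<Rightarrow> complex) \<Rightarrow> real \<Rightarrow> real \<Rightarrow> real \<Rightarrow> bool" where
  "hamm_le_bound f r\<^sub>0 r\<^sub>1 d \<longleftrightarrow> d > 0 \<and>
     (\<forall>r \<eta>. r\<^sub>1 \<le> r \<and> r \<le> r\<^sub>0 \<and> \<eta> \<noteq> 0 \<and> cmod \<eta> \<le> d \<longrightarrow>
        {z \<in> cball 0 r\<^sub>0. f z = \<eta>} \<noteq> {} \<and>
        (\<forall>p \<in> cball 0 r\<^sub>0. f p = \<eta> \<longrightarrow> \<not> mixed_critical f p) \<and>
        (\<forall>p \<in> sphere 0 r. f p = \<eta> \<longrightarrow> transverse_to_sphere_at f p))"

definition stable_milnor_radius ::
    "(complex ^ 'n) set \<Rightarrow> (complex ^ 'n \<Rightarrow> complex) \<Rightarrow> real \<Rightarrow> bool" where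
  "stable_milnor_radius U f r\<^sub>0 \<longleftrightarrow> r\<^sub>0 > 0 \<and> cball 0 r\<^sub>0 \<subseteq> U \<and>
     (\<forall>r\<^sub>1. 0 < r\<^sub>1 \<and> r\<^sub>1 \<le> r\<^sub>0 \<longrightarrow> (\<exists>d. hamm_le_bound f r\<^sub>0 r\<^sub>1 d))"

definition hamm_le_condition ::
    "(complex ^ 'n) set \<Rightarrow> (complex ^ 'n \<Rightarrow> complex) \<Rightarrow> bool" where
  "hamm_le_condition U f \<longleftrightarrow> (\<exists>r\<^sub>0. stable_milnor_radius U f r\<^sub>0)"

definition milnor_fiber ::
    "(complex ^ 'n \<Rightarrow> complex) \<Rightarrow> real \<Rightarrow> real \<Rightarrow> (complex ^ 'n) set" where
  "milnor_fiber f r \<delta> = {z \<in> cball 0 r. f z = complex_of_real \<delta>}"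

definition C1_on :: "'a set \<Rightarrow> ('a::euclidean_space \<Rightarrow> 'a) \<Rightarrow> bool" where
  "C1_on W g \<longleftrightarrow> (\<exists>D :: 'a \<Rightarrow> 'a \<Rightarrow>\<^sub>L 'a.
     (\<forall>x\<in>W. (g has_derivative blinfun_apply (D x)) (at x)) \<and> continuous_on W D)"

text \<open>
  A \<open>d\<close>-dimensional embedded submanifold: near each of its points some local \<open>C\<^sup>1\<close>
  diffeomorphism \<open>\<phi>\<close> of the ambient space, with inverse \<open>\<psi>\<close>, maps it to a \<open>d\<close>-dimensional
  linear subspace.
\<close>

definition C1_submanifold :: "nat \<Rightarrow> 'a::euclidean_space set \<Rightarrow> bool" where
  "C1_submanifold d M \<longleftrightarrow> (\<forall>p\<in>M. \<exists>W W' \<phi> \<psi> L.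
     open W \<and> open W' \<and> p \<in> W \<and> homeomorphism W W' \<phi> \<psi> \<and> C1_on W \<phi> \<and> C1_on W' \<psi> \<and>
     subspace L \<and> dim L = d \<and> \<phi> ` (M \<inter> W) = L \<inter> W')"

text \<open>
  The dimension of a nonempty real analytic set \<open>V\<close> is the largest dimension of a submanifold
  contained in \<open>V\<close>. For such sets the differentiability class of the submanifolds does not matter.
  The set of dimensions is nonempty, as points are submanifolds, and bounded by
  the dimension of the ambient space.
\<close>

definition real_dimension :: "'a::euclidean_space set \<Rightarrow> nat" where
  "real_dimension V = Max {d. \<exists>M. M \<noteq> {} \<and> M \<subseteq> V \<and> C1_submanifold d M}"

end

theory Submission
  imports Defs "HOL-Complex_Analysis.Cauchy_Integral_Formula"
begin

text \<open>
  Write \<open>K(\<eta>, s)\<close> for the fibre over \<open>\<eta>\<close> in the closed ball of radius \<open>s\<close>. By the Hamm-Le condition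
  and the inverse function theorem, the set of components of \<open>K(\<eta>, s)\<close> is locally constant for
  \<open>0 < |\<eta>| \<le> d\<close>, \<open>r\<^sub>1 \<le> s \<le> r\<^sub>0\<close>; no flows are needed. So it suffices that \<open>K(\<eta>, r\<^sub>0)\<close> is connected
  for one small \<open>\<eta>\<close>.

  A nonempty clopen part of the tube \<open>0 < |f| \<le> e\<close> surjects onto the punctured disc, and a point of least
  norm on its fibre over a small \<open>\<eta>\<close> lies, by transversality, in a tiny ball \<open>B\<close>. But \<open>B\<close> minus the
  zero set of \<open>f\<close> is connected, as a real analytic set of codimension two cannot separate. Hence
  the tube is connected. The components of the fibres that pass near the smooth zero \<open>w\<close> form a
  nonempty clopen subset of the tube, so there are no other components.
\<close>

subsection \<open>Submersions\<close>

text \<open>The tube can be connected while its fibres are not, since going around \<open>0\<close>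
  may permute the components of a fibre. The smooth zero rules this out: near \<open>w\<close> the
  map \<open>f\<close> is a submersion onto a full disc, so one component is marked consistently
  over the whole punctured disc, and no monodromy moves it. The dimension hypothesis speaks only of
  submanifolds contained in the zero set and says nothing about its shape at singular points; no
  stratification is used. A hypothetical separation is therefore turned into a C1 hypersurface
  inside the zero set. This takes derivatives of every order and an identity principle, so a mixed
  function is extended to a holomorphic function in which z and its conjugate become independent
  variables. All local information comes from one normal form for C1 submersions. It is applied to
  \<open>f\<close>, to the pair of \<open>f\<close> and the squared norm where a fibre is transverse
  to a sphere, and to a real function that cuts out the hypersurface.\<close>

lemma linear_blinfun: "linear (blinfun_apply T)"
  by (simp add: blinfun.bounded_linear_right bounded_linear.linear)

definition has_C1_derivative_on ::
    "('a::euclidean_space \<Rightarrow> 'b::euclidean_space) \<Rightarrow> ('a \<Rightarrow> 'a \<Rightarrow>\<^sub>L 'b) \<Rightarrow> 'a set \<Rightarrow> bool" where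
  "has_C1_derivative_on g D G \<longleftrightarrow>
     (\<forall>x\<in>G. (g has_derivative blinfun_apply (D x)) (at x)) \<and> continuous_on G D"

lemma has_C1_derivative_on_subset:
  "has_C1_derivative_on g D G \<Longrightarrow> H \<subseteq> G \<Longrightarrow> has_C1_derivative_on g D H"
  unfolding has_C1_derivative_on_def by (auto intro: continuous_on_subset)

lemma has_C1_derivative_on_imp_continuous_on:
  "has_C1_derivative_on g D G \<Longrightarrow> continuous_on G g"
  unfolding has_C1_derivative_on_def
  by (meson continuous_at_imp_continuous_on has_derivative_continuous)

text \<open>The identity \<open>E y - E y0 = E y o\<^sub>L (A y0 - A y) o\<^sub>L E y0\<close>
  reduces continuity to a bound on \<open>E y\<close>. Once
  \<open>norm (A y - A y0) * norm (E y0) < 1/2\<close>, the same identity gives that bound,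
  \<open>norm (E y) \<le> 2 * norm (E y0)\<close>.\<close>

lemma continuous_on_blinfun_inverse:
  fixes A E :: "'p::metric_space \<Rightarrow> 'a::real_normed_vector \<Rightarrow>\<^sub>L 'a"
  assumes A: "continuous_on V A"
    and EA: "\<And>y. y \<in> V \<Longrightarrow> E y o\<^sub>L A y = id_blinfun"
    and AE: "\<And>y. y \<in> V \<Longrightarrow> A y o\<^sub>L E y = id_blinfun"
  shows "continuous_on V E"
proof (unfold continuous_on_def, intro ballI)
  fix y0 assume y0: "y0 \<in> V"
  have At: "(A \<longlongrightarrow> A y0) (at y0 within V)"
    using A y0 by (auto simp: continuous_on_def)
  have eq: "E y - E y0 = E y o\<^sub>L (A y0 - A y) o\<^sub>L E y0" if "y \<in> V" for y
  proof (rule blinfun_eqI)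
    fix i
    have 1: "A y0 (E y0 i) = i" using AE[OF y0] by (metis blinfun_apply_blinfun_compose blinfun_apply_id_blinfun)
    have 2: "E y (A y (E y0 i)) = E y0 i" using EA[OF that] by (metis blinfun_apply_blinfun_compose blinfun_apply_id_blinfun)
    show "(E y - E y0) i = (E y o\<^sub>L (A y0 - A y) o\<^sub>L E y0) i"
      by (simp add: blinfun.bilinear_simps 1 2)
  qed
  define K where "K = norm (E y0)"
  have bd: "norm (E y - E y0) \<le> norm (E y) * (norm (A y - A y0) * K)" if "y \<in> V" for y
  proof -
    have "norm (E y o\<^sub>L (A y0 - A y) o\<^sub>L E y0) \<le> norm (E y) * norm (A y0 - A y) * norm (E y0)"
      by (meson norm_blinfun_compose mult_right_mono norm_ge_zero order_trans)
    then show ?thesis using eq[OF that] by (simp add: K_def norm_minus_commute mult.assoc)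
  qed
  have t0: "((\<lambda>y. norm (A y - A y0) * K) \<longlongrightarrow> 0) (at y0 within V)"
    using At by (auto intro!: tendsto_eq_intros simp: tendsto_norm_zero_iff LIM_zero_iff)
  then have ev: "\<forall>\<^sub>F y in at y0 within V. norm (A y - A y0) * K < 1/2"
    by (rule order_tendstoD) simp
  have inV: "\<forall>\<^sub>F y in at y0 within V. y \<in> V"
    by (simp add: eventually_at_filter)
  have main: "\<forall>\<^sub>F y in at y0 within V. norm (E y - E y0) \<le> 2 * K * (norm (A y - A y0) * K)"
    using ev inV
  proof eventually_elim
    case (elim y)
    let ?d = "norm (A y - A y0) * K"
    have d0: "0 \<le> ?d" by (simp add: K_def)
    have "norm (E y) \<le> K + norm (E y - E y0)"
      unfolding K_def by (metis norm_triangle_sub)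
    also have "\<dots> \<le> K + norm (E y) * ?d" using bd elim by simp
    also have "norm (E y) * ?d \<le> norm (E y) * (1/2)"
      using elim by (intro mult_left_mono) auto
    finally have "norm (E y) \<le> 2 * K" by simp
    then have "norm (E y) * ?d \<le> 2 * K * ?d" using d0 by (rule mult_right_mono)
    then show ?case using bd[of y] elim by linarith
  qed
  have "((\<lambda>y. 2 * K * (norm (A y - A y0) * K)) \<longlongrightarrow> 0) (at y0 within V)"
    using tendsto_mult[OF tendsto_const[of "2*K"] t0] by simp
  then have "((\<lambda>y. E y - E y0) \<longlongrightarrow> 0) (at y0 within V)"
    by (rule Lim_null_comparison[OF main])
  then show "(E \<longlongrightarrow> E y0) (at y0 within V)" by (simp add: LIM_zero_iff)
qed

text \<open>
  With \<open>T\<close> the derivative of \<open>g\<close> at \<open>p\<close> and \<open>S\<close> a linear right inverse of \<open>T\<close>, the map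
  \<open>\<Phi> x = S (g x) + (x - S (T x))\<close> has derivative the identity at \<open>p\<close>, and \<open>T \<circ> \<Phi> = g\<close>.
\<close>

lemma submersion_chart:
  fixes g :: "'a::euclidean_space \<Rightarrow> 'b::euclidean_space"
  assumes G: "open G" "p \<in> G" and g: "has_C1_derivative_on g D G"
    and sur: "surj (blinfun_apply (D p))"
  obtains N \<Phi> \<Psi> e where "open N" "p \<in> N" "N \<subseteq> G" "0 < e"
    "homeomorphism N (ball (\<Phi> p) e) \<Phi> \<Psi>" "C1_on N \<Phi>" "C1_on (ball (\<Phi> p) e) \<Psi>"
    "\<And>x. x \<in> N \<Longrightarrow> D p (\<Phi> x) = g x"
proof -
  define T where "T = D p"
  obtain S0 where S0: "linear S0" "blinfun_apply T \<circ> S0 = id"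
    using linear_surjective_right_inverse[OF linear_blinfun sur] unfolding T_def by blast
  define S where "S = Blinfun S0"
  have S: "blinfun_apply S = S0"
    unfolding S_def by (rule bounded_linear_Blinfun_apply) (use S0 in \<open>simp add: linear_conv_bounded_linear\<close>)
  have TS: "T (S x) = x" for x using S0(2) by (metis S comp_apply id_apply)
  define \<Phi> where "\<Phi> = (\<lambda>x. S (g x) + (x - S (T x)))"
  define D\<Phi> where "D\<Phi> = (\<lambda>x. (S o\<^sub>L D x) + (id_blinfun - (S o\<^sub>L T)))"
  have T\<Phi>: "T (\<Phi> x) = g x" for x
    by (simp add: \<Phi>_def blinfun.bilinear_simps TS)
  have d\<Phi>: "(\<Phi> has_derivative blinfun_apply (D\<Phi> x)) (at x)" if "x \<in> G" for x
    unfolding \<Phi>_def D\<Phi>_def using g that unfolding has_C1_derivative_on_def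
    by (auto intro!: derivative_eq_intros simp: blinfun.bilinear_simps)
  have c\<Phi>: "continuous_on G D\<Phi>"
    unfolding D\<Phi>_def using g unfolding has_C1_derivative_on_def
    by (auto intro!: continuous_intros bounded_bilinear.continuous_on[OF bounded_bilinear_blinfun_compose])
  \<comment> \<open>The two terms with \<open>S\<close> cancel at \<open>p\<close>, so the identity
    is the left inverse that the inverse function theorem asks for.\<close>
  have "id_blinfun o\<^sub>L D\<Phi> p = id_blinfun"
    by (rule blinfun_eqI) (simp add: D\<Phi>_def T_def blinfun.bilinear_simps)
  from inverse_function_theorem[OF G(1) d\<Phi> c\<Phi> G(2) this]
  obtain U' V \<Psi> g' where U': "open U'" "U' \<subseteq> G" "p \<in> U'" and V: "open V" "\<Phi> p \<in> V"
    and hom: "homeomorphism U' V \<Phi> \<Psi>"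
    and d\<Psi>: "\<And>y. y \<in> V \<Longrightarrow> (\<Psi> has_derivative (g' y)) (at y)"
    and g': "\<And>y. y \<in> V \<Longrightarrow> g' y = inv (blinfun_apply (D\<Phi> (\<Psi> y)))"
    and bij: "\<And>y. y \<in> V \<Longrightarrow> bij (blinfun_apply (D\<Phi> (\<Psi> y)))"
    by metis
  define E where "E = (\<lambda>y. Blinfun (g' y))"
  have E: "blinfun_apply (E y) = g' y" if "y \<in> V" for y
    unfolding E_def by (rule bounded_linear_Blinfun_apply) (use d\<Psi>[OF that] has_derivative_bounded_linear in blast)
  have c: "continuous_on V (\<lambda>y. D\<Phi> (\<Psi> y))"
    using hom U' by (intro continuous_on_compose2[OF c\<Phi>]) (auto simp: homeomorphism_def)
  have cE: "continuous_on V E"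
  proof (rule continuous_on_blinfun_inverse[OF c])
    fix y assume y: "y \<in> V"
    show "E y o\<^sub>L D\<Phi> (\<Psi> y) = id_blinfun"
      by (rule blinfun_eqI) (use E[OF y] g'[OF y] bij[OF y] in \<open>simp add: bij_is_inj\<close>)
    show "D\<Phi> (\<Psi> y) o\<^sub>L E y = id_blinfun"
      by (rule blinfun_eqI) (use E[OF y] g'[OF y] bij[OF y] in \<open>simp add: bij_is_surj surj_f_inv_f\<close>)
  qed
  \<comment> \<open>A ball as target is convex, and stays so when cut with the linear preimage of a
    convex set; this is how connectedness is obtained later.\<close>
  obtain e where e: "0 < e" "ball (\<Phi> p) e \<subseteq> V" using V openE by blast
  define N where "N = U' \<inter> \<Phi> -` ball (\<Phi> p) e"
  have "open N" unfolding N_def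
    using hom U' by (intro continuous_open_preimage) (auto simp: homeomorphism_def)
  moreover have "p \<in> N" using U' e by (simp add: N_def)
  moreover have "N \<subseteq> G" using U' by (auto simp: N_def)
  moreover have hN: "homeomorphism N (ball (\<Phi> p) e) \<Phi> \<Psi>"
  proof -
    have "\<Phi> ` N = ball (\<Phi> p) e"
    proof
      show "ball (\<Phi> p) e \<subseteq> \<Phi> ` N"
      proof
        fix y assume y: "y \<in> ball (\<Phi> p) e"
        then have "y \<in> V" using e by auto
        then have "\<Psi> y \<in> U'" "\<Phi> (\<Psi> y) = y" using hom by (auto simp: homeomorphism_def)
        then show "y \<in> \<Phi> ` N" using y unfolding N_def by (intro image_eqI[of _ _ "\<Psi> y"]) auto
      qed
    qed (auto simp: N_def)
    then show ?thesis
      using homeomorphism_of_subsets[OF hom, of N "ball (\<Phi> p) e"] e(2) by (auto simp: N_def)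
  qed
  moreover have "C1_on N \<Phi>" unfolding C1_on_def
    using d\<Phi> c\<Phi> \<open>N \<subseteq> G\<close> by (intro exI[of _ D\<Phi>]) (auto intro: continuous_on_subset)
  moreover have "C1_on (ball (\<Phi> p) e) \<Psi>" unfolding C1_on_def
    using d\<Psi> E cE e by (intro exI[of _ E]) (auto intro: continuous_on_subset simp: subset_iff)
  moreover have "\<And>x. x \<in> N \<Longrightarrow> D p (\<Phi> x) = g x"
    using T\<Phi> by (simp add: T_def)
  ultimately show ?thesis by (intro that[OF _ _ _ e(1)])
qed

text \<open>In the chart, \<open>g\<close> is the linear map \<open>D p\<close> on a ball, so all
  three conclusions are linear facts carried over by \<open>\<Psi>\<close>. They serve connectedness
  of local fibres, their persistence under change of the value, and the contradiction with the
  dimension.\<close>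

lemma submersion_local_structure:
  fixes g :: "'a::euclidean_space \<Rightarrow> 'b::euclidean_space"
  assumes G: "open G" "p \<in> G" and g: "has_C1_derivative_on g D G"
    and sur: "surj (blinfun_apply (D p))"
  obtains N where "open N" "p \<in> N" "N \<subseteq> G"
    "\<And>C. convex C \<Longrightarrow> connected (N \<inter> g -` C)"
    "\<And>y W. y \<in> N \<Longrightarrow> open W \<Longrightarrow> y \<in> W \<Longrightarrow> \<exists>e>0. \<forall>c\<in>ball (g y) e. \<exists>z\<in>N \<inter> W. g z = c"
    "C1_submanifold (dim {v. D p v = 0}) (N \<inter> g -` {0})"
proof -
  obtain N \<Phi> \<Psi> e where N: "open N" "p \<in> N" "N \<subseteq> G" and e: "0 < e"
    and hom: "homeomorphism N (ball (\<Phi> p) e) \<Phi> \<Psi>"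
    and C1: "C1_on N \<Phi>" "C1_on (ball (\<Phi> p) e) \<Psi>"
    and T: "\<And>x. x \<in> N \<Longrightarrow> D p (\<Phi> x) = g x"
    by (rule submersion_chart[OF assms]) (rule that; assumption)
  let ?B = "ball (\<Phi> p) e"
  have h: "\<And>x. x \<in> N \<Longrightarrow> \<Phi> x \<in> ?B \<and> \<Psi> (\<Phi> x) = x" "\<And>y. y \<in> ?B \<Longrightarrow> \<Psi> y \<in> N \<and> \<Phi> (\<Psi> y) = y"
    "continuous_on ?B \<Psi>"
    using hom by (auto simp: homeomorphism_def)
  have eq: "N \<inter> g -` C = \<Psi> ` (?B \<inter> blinfun_apply (D p) -` C)" for C
  proof
    show "N \<inter> g -` C \<subseteq> \<Psi> ` (?B \<inter> blinfun_apply (D p) -` C)"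
    proof
      fix x assume x: "x \<in> N \<inter> g -` C"
      then have "x = \<Psi> (\<Phi> x)" "\<Phi> x \<in> ?B" "D p (\<Phi> x) \<in> C" using h(1)[of x] T[of x] by auto
      then show "x \<in> \<Psi> ` (?B \<inter> blinfun_apply (D p) -` C)" by blast
    qed
    show "\<Psi> ` (?B \<inter> blinfun_apply (D p) -` C) \<subseteq> N \<inter> g -` C"
    proof
      fix x assume "x \<in> \<Psi> ` (?B \<inter> blinfun_apply (D p) -` C)"
      then obtain y where y: "x = \<Psi> y" "y \<in> ?B" "D p y \<in> C" by blast
      then show "x \<in> N \<inter> g -` C" using h(2)[OF y(2)] T[of x] by auto
    qed
  qed
  have "connected (N \<inter> g -` C)" if "convex C" for C
  proof -
    have "convex (?B \<inter> blinfun_apply (D p) -` C)"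
      by (intro convex_Int convex_ball convex_linear_vimage that)
         (simp add: linear_blinfun)
    then show ?thesis unfolding eq
      by (intro connected_continuous_image convex_connected continuous_on_subset[OF h(3)]) auto
  qed
  moreover have "\<exists>e>0. \<forall>c\<in>ball (g y) e. \<exists>z\<in>N \<inter> W. g z = c" if y: "y \<in> N" and W: "open W" "y \<in> W" for y W
  proof -
    obtain S where S: "linear S" "blinfun_apply (D p) \<circ> S = id"
      using linear_surjective_right_inverse[OF linear_blinfun sur] by blast
    have DS: "D p (S c) = c" for c using S(2) by (metis comp_apply id_apply)
    have cS: "continuous_on UNIV S" using S(1) linear_continuous_on linear_conv_bounded_linear by blast
    have oW: "open (?B \<inter> \<Psi> -` W)" by (intro continuous_open_preimage h W) auto
    \<comment> \<open>Moving from \<open>\<Phi> y\<close> along the right inverse \<open>S\<close>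
      changes the value of \<open>D p\<close> from \<open>g y\<close> to exactly
      \<open>c\<close>.\<close>
    let ?k = "\<lambda>c. \<Phi> y + S (c - g y)"
    have "open (?k -` (?B \<inter> \<Psi> -` W))"
      by (intro open_vimage oW continuous_intros continuous_on_compose2[OF cS]) auto
    moreover have "g y \<in> ?k -` (?B \<inter> \<Psi> -` W)"
      using h y W linear_0[OF S(1)] by auto
    ultimately obtain d where d: "d > 0" "ball (g y) d \<subseteq> ?k -` (?B \<inter> \<Psi> -` W)"
      using openE by blast
    have "\<exists>z\<in>N \<inter> W. g z = c" if "c \<in> ball (g y) d" for c
    proof
      have k: "?k c \<in> ?B" "\<Psi> (?k c) \<in> W" using d that by auto
      show "\<Psi> (?k c) \<in> N \<inter> W" using k(2) h(2)[OF k(1)] by blast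
      have "g (\<Psi> (?k c)) = D p (\<Phi> (\<Psi> (?k c)))" using T h(2)[OF k(1)] by metis
      also have "\<dots> = D p (?k c)" using h(2)[OF k(1)] by metis
      also have "\<dots> = c" using T[OF y] by (simp add: blinfun.bilinear_simps DS)
      finally show "g (\<Psi> (?k c)) = c" .
    qed
    then show ?thesis using d by blast
  qed
  moreover have "C1_submanifold (dim {v. D p v = 0}) (N \<inter> g -` {0})"
  proof -
    have "\<Phi> ` (N \<inter> g -` {0} \<inter> N) = {v. D p v = 0} \<inter> ?B"
    proof
      show "\<Phi> ` (N \<inter> g -` {0} \<inter> N) \<subseteq> {v. D p v = 0} \<inter> ?B"
        using h(1) T by auto
      show "{v. D p v = 0} \<inter> ?B \<subseteq> \<Phi> ` (N \<inter> g -` {0} \<inter> N)"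
      proof
        fix y assume y: "y \<in> {v. D p v = 0} \<inter> ?B"
        then have "y = \<Phi> (\<Psi> y)" "\<Psi> y \<in> N" "g (\<Psi> y) = 0"
          using h(2)[of y] T[of "\<Psi> y"] by auto
        then show "y \<in> \<Phi> ` (N \<inter> g -` {0} \<inter> N)" by blast
      qed
    qed
    moreover have "subspace {v. D p v = 0}"
      by (simp add: linear_blinfun linear_subspace_kernel)
    ultimately show ?thesis unfolding C1_submanifold_def
      by (intro ballI exI[of _ N] exI[of _ ?B] exI[of _ \<Phi>] exI[of _ \<Psi>] exI[of _ "{v. D p v = 0}"])
         (use N hom C1 in simp)
  qed
  ultimately show ?thesis by (rule that[OF N])
qed

lemma dim_kernel_functional:
  fixes T :: "'a::euclidean_space \<Rightarrow>\<^sub>L real"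
  assumes "surj (blinfun_apply T)"
  shows "dim {v. T v = 0} = DIM('a) - 1"
proof -
  define a where "a = adjoint (blinfun_apply T) 1"
  have a: "a \<bullet> v = T v" for v
    using adjoint_works[OF linear_blinfun, of v T 1] by (simp add: a_def inner_commute)
  have "a \<noteq> 0"
  proof
    assume "a = 0"
    then have "T v = 0" for v using a by (metis inner_zero_left)
    with assms show False by (metis surj_def zero_neq_one)
  qed
  then show ?thesis using dim_hyperplane[of a] a by simp
qed

subsection \<open>Families of compact sets with locally constant components\<close>

text \<open>A weak substitute for local triviality of a fibration: the sets do not escape from
  neighbourhoods of the limit, and near each limit point there are small windows in which they stay
  connected and nonempty. This suffices to control components. A filter is used so that parameters
  may be confined to a subset.\<close>

definition locally_trivial_pi0 :: "'l filter \<Rightarrow> ('l \<Rightarrow> 'a::euclidean_space set) \<Rightarrow> 'a set \<Rightarrow> bool" where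
  "locally_trivial_pi0 F K K\<^sub>0 \<longleftrightarrow> compact K\<^sub>0 \<and>
     (\<forall>G. open G \<and> K\<^sub>0 \<subseteq> G \<longrightarrow> (\<forall>\<^sub>F m in F. K m \<subseteq> G)) \<and>
     (\<forall>p\<in>K\<^sub>0. \<forall>G. open G \<and> p \<in> G \<longrightarrow>
        (\<exists>N. open N \<and> p \<in> N \<and> N \<subseteq> G \<and> (\<forall>\<^sub>F m in F. connected (N \<inter> K m) \<and> N \<inter> K m \<noteq> {})))"

context
  fixes F :: "'l filter" and K :: "'l \<Rightarrow> 'a::euclidean_space set" and K\<^sub>0
  assumes lt: "locally_trivial_pi0 F K K\<^sub>0"
begin

lemma ltp_compact: "compact K\<^sub>0"
  using lt by (simp add: locally_trivial_pi0_def)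

lemma ltp_upper: "open G \<Longrightarrow> K\<^sub>0 \<subseteq> G \<Longrightarrow> \<forall>\<^sub>F m in F. K m \<subseteq> G"
  using lt by (simp add: locally_trivial_pi0_def)

lemma ltp_local:
  assumes "p \<in> K\<^sub>0" "open G" "p \<in> G"
  obtains N where "open N" "p \<in> N" "N \<subseteq> G" "\<forall>\<^sub>F m in F. connected (N \<inter> K m) \<and> N \<inter> K m \<noteq> {}"
  using lt assms unfolding locally_trivial_pi0_def by meson

lemma ltp_lower:
  assumes "open G" "G \<inter> K\<^sub>0 \<noteq> {}"
  shows "\<forall>\<^sub>F m in F. G \<inter> K m \<noteq> {}"
proof -
  obtain p where p: "p \<in> G" "p \<in> K\<^sub>0" using assms by blast
  from ltp_local[OF p(2) assms(1) p(1)] obtain N where "N \<subseteq> G" "\<forall>\<^sub>F m in F. connected (N \<inter> K m) \<and> N \<inter> K m \<noteq> {}"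
    by metis
  then show ?thesis by (auto elim!: eventually_mono)
qed

text \<open>Cover the limit by finitely many windows. Nearby sets are covered by the same windows,
  each piece is connected, and pieces that overlap in the limit still overlap. A separation of
  \<open>K m\<close> thus sorts the windows into two groups that would separate the limit.\<close>

lemma eventually_connected:
  assumes con: "connected K\<^sub>0"
  shows "\<forall>\<^sub>F m in F. connected (K m)"
proof -
  have "\<exists>N. \<forall>p\<in>K\<^sub>0. open (N p) \<and> p \<in> N p \<and> (\<forall>\<^sub>F m in F. connected (N p \<inter> K m) \<and> N p \<inter> K m \<noteq> {})"
  proof (rule bchoice, rule ballI)
    fix p assume "p \<in> K\<^sub>0"
    from ltp_local[OF this open_UNIV UNIV_I]
    show "\<exists>N. open N \<and> p \<in> N \<and> (\<forall>\<^sub>F m in F. connected (N \<inter> K m) \<and> N \<inter> K m \<noteq> {})" by metis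
  qed
  then obtain N where N: "\<And>p. p \<in> K\<^sub>0 \<Longrightarrow> open (N p)" "\<And>p. p \<in> K\<^sub>0 \<Longrightarrow> p \<in> N p"
    "\<And>p. p \<in> K\<^sub>0 \<Longrightarrow> \<forall>\<^sub>F m in F. connected (N p \<inter> K m) \<and> N p \<inter> K m \<noteq> {}" by blast
  obtain I where I: "I \<subseteq> K\<^sub>0" "finite I" "K\<^sub>0 \<subseteq> (\<Union>p\<in>I. N p)"
    using compactE_image[OF ltp_compact, of K\<^sub>0 N] N by blast
  have e1: "\<forall>\<^sub>F m in F. K m \<subseteq> (\<Union>p\<in>I. N p)"
    using I N by (intro ltp_upper) auto
  have e2: "\<forall>\<^sub>F m in F. \<forall>p\<in>I. connected (N p \<inter> K m) \<and> N p \<inter> K m \<noteq> {}"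
    using I N by (intro eventually_ball_finite) auto
  have e3: "\<forall>\<^sub>F m in F. \<forall>p\<in>I. \<forall>q\<in>I. N p \<inter> N q \<inter> K\<^sub>0 \<noteq> {} \<longrightarrow> N p \<inter> N q \<inter> K m \<noteq> {}"
  proof (intro eventually_ball_finite ballI I(2))
    fix p q assume "p \<in> I" "q \<in> I"
    then show "\<forall>\<^sub>F m in F. N p \<inter> N q \<inter> K\<^sub>0 \<noteq> {} \<longrightarrow> N p \<inter> N q \<inter> K m \<noteq> {}"
      using ltp_lower[of "N p \<inter> N q"] N(1) I(1)
      by (cases "N p \<inter> N q \<inter> K\<^sub>0 = {}") auto
  qed
  show ?thesis
  proof (rule eventually_mono[OF eventually_conj[OF e1 eventually_conj[OF e2 e3]]])
    fix m
    assume m: "K m \<subseteq> (\<Union>p\<in>I. N p) \<and> (\<forall>p\<in>I. connected (N p \<inter> K m) \<and> N p \<inter> K m \<noteq> {}) \<and>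
      (\<forall>p\<in>I. \<forall>q\<in>I. N p \<inter> N q \<inter> K\<^sub>0 \<noteq> {} \<longrightarrow> N p \<inter> N q \<inter> K m \<noteq> {})"
    have cover: "K m \<subseteq> (\<Union>p\<in>I. N p)" using m by (rule conjunct1)
    have piece: "connected (N p \<inter> K m)" "N p \<inter> K m \<noteq> {}" if "p \<in> I" for p
      using bspec[OF conjunct1[OF conjunct2[OF m]] that] by auto
    have meet: "N p \<inter> N q \<inter> K m \<noteq> {}" if "p \<in> I" "q \<in> I" "N p \<inter> N q \<inter> K\<^sub>0 \<noteq> {}" for p q
      using mp[OF bspec[OF bspec[OF conjunct2[OF conjunct2[OF m]] that(1)] that(2)] that(3)] .
    show "connected (K m)"
    proof (rule connectedI)
      fix A B assume AB: "open A" "open B" "A \<inter> K m \<noteq> {}" "B \<inter> K m \<noteq> {}" "A \<inter> B \<inter> K m = {}" "K m \<subseteq> A \<union> B"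
      \<comment> \<open>Each piece is connected, so it lies wholly in \<open>A\<close> or wholly in
        \<open>B\<close>; \<open>P\<close> and \<open>Q\<close> are the resulting groups of
        windows.\<close>
      define P where "P = {p\<in>I. A \<inter> (N p \<inter> K m) \<noteq> {}}"
      define Q where "Q = {p\<in>I. B \<inter> (N p \<inter> K m) \<noteq> {}}"
      have PQ: "P \<union> Q = I"
      proof -
        have "p \<in> P \<or> p \<in> Q" if p: "p \<in> I" for p
        proof -
          obtain z where z: "z \<in> N p \<inter> K m" using piece(2)[OF p] by blast
          then have "z \<in> A \<or> z \<in> B" using AB(6) by blast
          then show ?thesis using p z by (auto simp: P_def Q_def)
        qed
        then show ?thesis by (auto simp: P_def Q_def)
      qed
      have PI: "P \<subseteq> I" "Q \<subseteq> I" by (auto simp: P_def Q_def)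
      have sub: "N p \<inter> K m \<inter> B = {}" if "p \<in> P" for p
      proof -
        have "connected (N p \<inter> K m)" "A \<inter> (N p \<inter> K m) \<noteq> {}" using that piece(1)[of p] PI by (auto simp: P_def)
        then show ?thesis using connectedD[of "N p \<inter> K m" A B] AB by auto
      qed
      have disj: "N p \<inter> N q \<inter> K\<^sub>0 = {}" if "p \<in> P" "q \<in> Q" for p q
      proof (rule ccontr)
        assume "N p \<inter> N q \<inter> K\<^sub>0 \<noteq> {}"
        then have "N p \<inter> N q \<inter> K m \<noteq> {}" using meet that PI by auto
        then obtain z where z: "z \<in> N p" "z \<in> N q" "z \<in> K m" by blast
        then have "z \<in> A" using sub[OF that(1)] AB by blast
        moreover have "connected (N q \<inter> K m)" using piece(1) that PI by auto
        then have "A \<inter> (N q \<inter> K m) = {} \<or> B \<inter> (N q \<inter> K m) = {}"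
          using AB by (intro connectedD) auto
        ultimately show False using z that unfolding Q_def by blast
      qed
      have "\<exists>p\<in>I. z \<in> N p" if "z \<in> K m" for z using cover that by auto
      then have "\<exists>p\<in>I. A \<inter> (N p \<inter> K m) \<noteq> {}" "\<exists>p\<in>I. B \<inter> (N p \<inter> K m) \<noteq> {}"
        using AB(3,4) by (auto simp: disjoint_iff) (meson IntI)+
      then have "P \<noteq> {}" "Q \<noteq> {}" unfolding P_def Q_def by auto
      then obtain p q where pq: "p \<in> P" "q \<in> Q" by blast
      have "p \<in> K\<^sub>0" "q \<in> K\<^sub>0" using pq PI I(1) by auto
      then have ne: "p \<in> (\<Union>p\<in>P. N p) \<inter> K\<^sub>0" "q \<in> (\<Union>q\<in>Q. N q) \<inter> K\<^sub>0"
        using pq N(2) by auto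
      have "open (\<Union>p\<in>P. N p)" "open (\<Union>q\<in>Q. N q)"
        using N(1) PI I(1) by (auto intro!: open_UN)
      moreover have "(\<Union>p\<in>P. N p) \<inter> (\<Union>q\<in>Q. N q) \<inter> K\<^sub>0 = {}"
      proof (rule ccontr)
        assume "(\<Union>p\<in>P. N p) \<inter> (\<Union>q\<in>Q. N q) \<inter> K\<^sub>0 \<noteq> {}"
        then obtain z p q where "z \<in> N p \<inter> N q \<inter> K\<^sub>0" "p \<in> P" "q \<in> Q" by auto
        then show False using disj by auto
      qed
      moreover have "K\<^sub>0 \<subseteq> (\<Union>p\<in>P. N p) \<union> (\<Union>q\<in>Q. N q)"
        using I(3) PQ by auto
      ultimately have "(\<Union>p\<in>P. N p) \<inter> K\<^sub>0 = {} \<or> (\<Union>q\<in>Q. N q) \<inter> K\<^sub>0 = {}"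
        by (rule connectedD[OF con])
      then show False using ne by auto
    qed
  qed
qed

text \<open>Disjoint open neighbourhoods of two closed parts of the limit contain
  \<open>K m\<close>, and both are still met by it.\<close>

lemma eventually_not_connected:
  assumes ncon: "\<not> connected K\<^sub>0"
  shows "\<forall>\<^sub>F m in F. \<not> connected (K m)"
proof -
  have cl: "closed K\<^sub>0" using ltp_compact by (rule compact_imp_closed)
  from ncon obtain A B where AB: "closed A" "closed B" "K\<^sub>0 \<subseteq> A \<union> B" "A \<inter> B \<inter> K\<^sub>0 = {}"
    "A \<inter> K\<^sub>0 \<noteq> {}" "B \<inter> K\<^sub>0 \<noteq> {}"
    unfolding connected_closed by blast
  obtain G H where GH: "open G" "open H" "A \<inter> K\<^sub>0 \<subseteq> G" "B \<inter> K\<^sub>0 \<subseteq> H" "G \<inter> H = {}"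
    by (rule separation_normal[of "A \<inter> K\<^sub>0" "B \<inter> K\<^sub>0"]) (use AB cl in auto)
  have "\<forall>\<^sub>F m in F. K m \<subseteq> G \<union> H" using GH AB by (intro ltp_upper) auto
  moreover have "\<forall>\<^sub>F m in F. G \<inter> K m \<noteq> {}" using GH AB by (intro ltp_lower) auto
  moreover have "\<forall>\<^sub>F m in F. H \<inter> K m \<noteq> {}" using GH AB by (intro ltp_lower) auto
  ultimately show ?thesis
  proof eventually_elim
    case (elim m)
    then show ?case using connectedD[of "K m" G H] GH(1,2,5) by auto
  qed
qed

end

text \<open>For nonempty connected \<open>P\<close> inside \<open>K\<close> this is the component of
  \<open>K\<close> through \<open>P\<close>. A base set replaces a base point because no continuous
  choice of a point is at hand.\<close>

definition component_containing :: "'a::topological_space set \<Rightarrow> 'a set \<Rightarrow> 'a set" where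
  "component_containing K P = {z. \<exists>C. connected C \<and> C \<subseteq> K \<and> P \<subseteq> C \<and> z \<in> C}"

text \<open>The component of \<open>K l\<close> through \<open>P l\<close> is both open and closed
  in \<open>K l\<close>, so it can be separated from the rest by \<open>G\<close> and
  \<open>H\<close>. Nearby, \<open>K m \<inter> G\<close> is connected by
  \<open>eventually_connected\<close> and contains \<open>P m\<close>. The hypothesis
  \<open>refl\<close> says that the filter also sees the parameter \<open>l\<close> itself.\<close>

lemma section_component_locally_clopen:
  fixes K :: "'l \<Rightarrow> 'a::euclidean_space set"
  assumes lt: "locally_trivial_pi0 F K (K l)"
    and refl: "\<And>Q. eventually Q F \<Longrightarrow> Q l"
    and P: "\<forall>\<^sub>F m in F. connected (P m) \<and> P m \<subseteq> K m" "P l \<noteq> {}"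
    and P_lower: "\<And>G. open G \<Longrightarrow> G \<inter> P l \<noteq> {} \<Longrightarrow> \<forall>\<^sub>F m in F. G \<inter> P m \<noteq> {}"
  obtains G H where "open G" "open H" "G \<inter> H = {}"
    "\<forall>\<^sub>F m in F. K m \<subseteq> G \<union> H \<and> component_containing (K m) (P m) = K m \<inter> G"
proof -
  note compact = ltp_compact[OF lt] and upper = ltp_upper[OF lt] and local = ltp_local[OF lt]
  have Pl: "connected (P l)" "P l \<subseteq> K l" using refl[OF P(1)] by auto
  obtain x where x: "x \<in> P l" using P by blast
  define C where "C = connected_component_set (K l) x"
  have PC: "P l \<subseteq> C" unfolding C_def using Pl x by (simp add: connected_component_maximal)
  have conC: "connected C" unfolding C_def by simp
  have CK: "C \<subseteq> K l" unfolding C_def by (simp add: connected_component_subset)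
  have "closedin (top_of_set (K l)) C" unfolding C_def by (rule closedin_connected_component)
  then have compC: "compact C" using compact closedin_compact by blast
  \<comment> \<open>Around each point a window of \<open>K l\<close> is connected, because the
    eventual statement holds at \<open>l\<close> by \<open>refl\<close>.\<close>
  have "openin (top_of_set (K l)) C"
  proof (subst openin_subopen, intro ballI)
    fix p assume p: "p \<in> C"
    then have "p \<in> K l" using CK by auto
    from local[OF this open_UNIV UNIV_I] obtain N where
      N: "open N" "p \<in> N" "\<forall>\<^sub>F m in F. connected (N \<inter> K m) \<and> N \<inter> K m \<noteq> {}"
      by metis
    have "connected (N \<inter> K l)" using refl[OF N(3)] by auto
    moreover have "C = connected_component_set (K l) p"
      using p unfolding C_def by (metis connected_component_eq)
    ultimately have "N \<inter> K l \<subseteq> C" using N \<open>p \<in> K l\<close> by (simp add: connected_component_maximal)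
    then show "\<exists>T. openin (top_of_set (K l)) T \<and> p \<in> T \<and> T \<subseteq> C"
      using N \<open>p \<in> K l\<close> by (intro exI[of _ "K l \<inter> N"]) auto
  qed
  then have "closedin (top_of_set (K l)) (K l - C)" by (simp add: closedin_def CK double_diff)
  then have "compact (K l - C)" using compact closedin_compact by blast
  then obtain G H where GH: "open G" "open H" "C \<subseteq> G" "K l - C \<subseteq> H" "G \<inter> H = {}"
    using separation_normal[of C "K l - C"] compC by (metis Diff_disjoint compact_imp_closed)
  \<comment> \<open>Cutting with \<open>G\<close> leaves a family whose limit is \<open>C\<close>
    alone, since everything else is caught by \<open>H\<close>.\<close>
  have "locally_trivial_pi0 F (\<lambda>m. K m \<inter> G) C"
    unfolding locally_trivial_pi0_def
  proof (intro conjI compC allI impI ballI; elim conjE)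
    fix W assume W: "open W" "C \<subseteq> W"
    have "\<forall>\<^sub>F m in F. K m \<subseteq> (W \<inter> G) \<union> H"
      using W GH by (intro upper) auto
    then show "\<forall>\<^sub>F m in F. K m \<inter> G \<subseteq> W"
      by eventually_elim (use GH in blast)
  next
    fix p W assume "p \<in> C" "open W" "p \<in> W"
    then have "p \<in> K l" "open (W \<inter> G)" "p \<in> W \<inter> G" using CK GH by auto
    from local[OF this] obtain N where N: "open N" "p \<in> N" "N \<subseteq> W \<inter> G"
      "\<forall>\<^sub>F m in F. connected (N \<inter> K m) \<and> N \<inter> K m \<noteq> {}" .
    have "N \<inter> (K m \<inter> G) = N \<inter> K m" for m using N by auto
    with N show "\<exists>N. open N \<and> p \<in> N \<and> N \<subseteq> W \<and> (\<forall>\<^sub>F m in F. connected (N \<inter> (K m \<inter> G)) \<and> N \<inter> (K m \<inter> G) \<noteq> {})"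
      by (intro exI[of _ N]) auto
  qed
  from eventually_connected[OF this conC]
  have "\<forall>\<^sub>F m in F. connected (K m \<inter> G)" .
  moreover have "\<forall>\<^sub>F m in F. K m \<subseteq> G \<union> H" using GH by (intro upper) auto
  moreover have "\<forall>\<^sub>F m in F. G \<inter> P m \<noteq> {}" using x PC GH by (intro P_lower) auto
  ultimately have "\<forall>\<^sub>F m in F. K m \<subseteq> G \<union> H \<and> component_containing (K m) (P m) = K m \<inter> G"
    using P(1)
  proof eventually_elim
    case (elim m)
    have in_G: "D \<subseteq> G" if "connected D" "D \<subseteq> K m" "P m \<subseteq> D" for D
      using connectedD[OF that(1) GH(1,2)] GH(5) elim that by blast
    have "component_containing (K m) (P m) = K m \<inter> G"
    proof
      show "component_containing (K m) (P m) \<subseteq> K m \<inter> G"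
        unfolding component_containing_def using in_G by blast
      show "K m \<inter> G \<subseteq> component_containing (K m) (P m)"
        unfolding component_containing_def using elim in_G[of "P m"] by blast
    qed
    with elim show ?case by blast
  qed
  then show ?thesis by (rule that[OF GH(1,2,5)])
qed

subsection \<open>Mixed functions as restrictions of holomorphic functions\<close>

lemma norm_vector_scalar_mult: "norm (t *s v) = cmod t * norm (v :: complex ^ 'm)"
proof -
  have "norm (t *s v) = L2_set (\<lambda>i. cmod t * norm (v $ i)) UNIV"
    by (simp add: norm_vec_def norm_mult)
  also have "\<dots> = cmod t * L2_set (\<lambda>i. norm (v $ i)) UNIV"
    by (simp add: L2_set_right_distrib)
  finally show ?thesis by (simp add: norm_vec_def)
qed

lemma has_derivative_complex_line:
  fixes v :: "complex ^ 'm"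
  shows "((\<lambda>t. y + t *s v) has_derivative (\<lambda>h. h *s v)) (at t within S)"
proof -
  have "bounded_linear (\<lambda>h. h *s v)"
    by (rule bounded_linear_intro[of _ "norm v"])
       (auto simp: vec_eq_iff algebra_simps norm_vector_scalar_mult)
  from has_derivative_add[OF has_derivative_const bounded_linear.has_derivative[OF this has_derivative_ident]]
  show ?thesis by simp
qed

inductive_set cpoly :: "(complex ^ 'm \<Rightarrow> complex) set" where
  const: "(\<lambda>z. c) \<in> cpoly"
| coord: "(\<lambda>z. z $ i) \<in> cpoly"
| add: "p \<in> cpoly \<Longrightarrow> q \<in> cpoly \<Longrightarrow> (\<lambda>z. p z + q z) \<in> cpoly"
| mult: "p \<in> cpoly \<Longrightarrow> q \<in> cpoly \<Longrightarrow> (\<lambda>z. p z * q z) \<in> cpoly"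

lemma cpoly_power: "p \<in> cpoly \<Longrightarrow> (\<lambda>z. p z ^ n) \<in> cpoly"
  by (induction n) (auto intro: cpoly.intros)

lemma cpoly_prod: "finite I \<Longrightarrow> (\<And>i. i \<in> I \<Longrightarrow> p i \<in> cpoly) \<Longrightarrow> (\<lambda>z. \<Prod>i\<in>I. p i z) \<in> cpoly"
  by (induction I rule: finite_induct) (auto intro: cpoly.intros)

text \<open>A real derivative that commutes with complex scalars, that is, holomorphy. In this form
  one-variable theory applies along complex lines \<open>t \<mapsto> y + t *s v\<close>.\<close>

definition complex_differential ::
    "(complex ^ 'm \<Rightarrow> complex) \<Rightarrow> (complex ^ 'm \<Rightarrow> complex ^ 'm \<Rightarrow> complex) \<Rightarrow> (complex ^ 'm) set \<Rightarrow> bool" where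
  "complex_differential F F' \<Omega> \<longleftrightarrow>
     (\<forall>z\<in>\<Omega>. (F has_derivative F' z) (at z) \<and> (\<forall>t v. F' z (t *s v) = t * F' z v))"

lemma complex_differential_line:
  assumes "complex_differential F F' \<Omega>" "y + t *s v \<in> \<Omega>"
  shows "((\<lambda>t. F (y + t *s v)) has_field_derivative F' (y + t *s v) v) (at t)"
proof -
  have "((\<lambda>t. F (y + t *s v)) has_derivative (\<lambda>h. F' (y + t *s v) (h *s v))) (at t)"
    using assms unfolding complex_differential_def
    by (intro has_derivative_compose[OF has_derivative_complex_line, of F]) auto
  moreover have "(\<lambda>h. F' (y + t *s v) (h *s v)) = (*) (F' (y + t *s v) v)"
    using assms unfolding complex_differential_def by (auto simp: mult.commute)
  ultimately show ?thesis unfolding has_field_derivative_def by metis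
qed

text \<open>Directional derivatives are recorded to be polynomials again, so that a differentiated
  series stays in the same class.\<close>

lemma cpoly_differential:
  assumes "p \<in> cpoly"
  shows "\<exists>p'. complex_differential p p' UNIV \<and> (\<forall>v. (\<lambda>z. p' z v) \<in> cpoly)"
  using assms
proof induction
  case (const c)
  have "complex_differential (\<lambda>z. c) (\<lambda>z v. 0) UNIV" by (simp add: complex_differential_def)
  then show ?case by (intro exI[of _ "\<lambda>z v. 0"]) (auto intro: cpoly.const)
next
  case (coord i)
  have "complex_differential (\<lambda>z. z $ i) (\<lambda>z v. v $ i) UNIV"
    by (auto simp: complex_differential_def intro: bounded_linear_imp_has_derivative bounded_linear_vec_nth)
  then show ?case by (intro exI[of _ "\<lambda>z v. v $ i"]) (auto intro: cpoly.const)
next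
  case (add p q)
  then obtain p' q' where "complex_differential p p' UNIV" "\<forall>v. (\<lambda>z. p' z v) \<in> cpoly"
    "complex_differential q q' UNIV" "\<forall>v. (\<lambda>z. q' z v) \<in> cpoly" by blast
  then show ?case
    by (intro exI[of _ "\<lambda>z v. p' z v + q' z v"])
       (auto simp: complex_differential_def algebra_simps intro!: has_derivative_add cpoly.add)
next
  case (mult p q)
  then obtain p' q' where "complex_differential p p' UNIV" "\<forall>v. (\<lambda>z. p' z v) \<in> cpoly"
    "complex_differential q q' UNIV" "\<forall>v. (\<lambda>z. q' z v) \<in> cpoly" by blast
  with mult.hyps show ?case
    by (intro exI[of _ "\<lambda>z v. p z * q' z v + p' z v * q z"])
       (auto simp: complex_differential_def distrib_left distrib_right mult.assoc mult.left_commute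
         intro!: has_derivative_mult cpoly.add cpoly.mult)
qed

text \<open>The one-variable Cauchy inequality along the line through \<open>y\<close> in direction
  \<open>v\<close>.\<close>

lemma complex_differential_cauchy_bound:
  assumes p: "complex_differential p p' UNIV" and e: "0 < e"
    and M: "\<And>y. y \<in> ball q e \<Longrightarrow> cmod (p y) \<le> M" and y: "y \<in> ball q (e/2)"
  shows "cmod (p' y v) \<le> 4 * M / e * norm v"
proof (cases "v = 0")
  case True
  have "linear (p' y)" using p has_derivative_linear unfolding complex_differential_def by blast
  then show ?thesis using True by (simp add: linear_0)
next
  case False
  define \<phi> where "\<phi> t = p (y + t *s v)" for t
  \<comment> \<open>On the circle of this radius the displacement has norm \<open>e / 4\<close>, so
    together with \<open>dist q y < e / 2\<close> it stays in \<open>ball q e\<close>.\<close>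
  define \<rho> where "\<rho> = e / (4 * norm v)"
  have d: "(\<phi> has_field_derivative p' (y + t *s v) v) (at t)" for t
    unfolding \<phi>_def by (rule complex_differential_line[OF p]) simp
  have "\<phi> holomorphic_on UNIV"
    unfolding holomorphic_on_def field_differentiable_def using d by blast
  then have "\<phi> holomorphic_on S" for S by (rule holomorphic_on_subset) simp
  moreover have "0 < \<rho>" using e False by (simp add: \<rho>_def)
  moreover have "cmod (\<phi> t) \<le> M" if t: "norm (0 - t) = \<rho>" for t
  proof -
    have "norm (t *s v) = e / 4" using t False by (simp add: norm_vector_scalar_mult \<rho>_def)
    then have "y + t *s v \<in> ball q e"
      using y e dist_triangle[of q "y + t *s v" y] by (simp add: dist_norm)
    then show ?thesis using M by (simp add: \<phi>_def)
  qed
  ultimately have "norm ((deriv ^^ 1) \<phi> 0) \<le> fact 1 * M / \<rho> ^ 1"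
    by (intro Cauchy_inequality) (auto intro: holomorphic_on_imp_continuous_on)
  moreover have "deriv \<phi> 0 = p' y v" using d[of 0] by (simp add: DERIV_imp_deriv)
  ultimately show ?thesis by (simp add: \<rho>_def field_simps)
qed

text \<open>
  Sums of polynomials, rather than power series, avoid multi-index bookkeeping: by the Cauchy
  estimates the termwise derivatives again converge locally normally.
\<close>

definition normal_cpoly_sum_on :: "(complex ^ 'm) set \<Rightarrow> (complex ^ 'm \<Rightarrow> complex) \<Rightarrow> bool" where
  "normal_cpoly_sum_on \<Omega> F \<longleftrightarrow> (\<exists>p :: nat \<Rightarrow> complex ^ 'm \<Rightarrow> complex. (\<forall>a. p a \<in> cpoly) \<and>
     (\<forall>q\<in>\<Omega>. \<exists>e>0. \<exists>M. summable M \<and> (\<forall>a. \<forall>y\<in>ball q e. cmod (p a y) \<le> M a)) \<and>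
     (\<forall>y\<in>\<Omega>. (\<lambda>a. p a y) sums F y))"

lemma normal_cpoly_sum_on_cong:
  "normal_cpoly_sum_on \<Omega> F \<Longrightarrow> (\<And>z. z \<in> \<Omega> \<Longrightarrow> F z = G z) \<Longrightarrow> normal_cpoly_sum_on \<Omega> G"
  unfolding normal_cpoly_sum_on_def by metis

text \<open>Keeping the directional derivatives inside the class is what gives derivatives of all
  orders by induction.\<close>

lemma normal_cpoly_sum_on_differential:
  assumes \<Omega>: "open \<Omega>" and F: "normal_cpoly_sum_on \<Omega> F"
  shows "\<exists>F'. complex_differential F F' \<Omega> \<and> (\<forall>v. normal_cpoly_sum_on \<Omega> (\<lambda>z. F' z v))"
proof -
  obtain p where p: "\<And>a. p a \<in> cpoly"
    and bnd: "\<And>q. q \<in> \<Omega> \<Longrightarrow> \<exists>e>0. \<exists>M. summable M \<and> (\<forall>a. \<forall>y\<in>ball q e. cmod (p a y) \<le> M a)"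
    and sums: "\<And>y. y \<in> \<Omega> \<Longrightarrow> (\<lambda>a. p a y) sums F y"
    using F unfolding normal_cpoly_sum_on_def by metis
  have "\<forall>a. \<exists>p'. complex_differential (p a) p' UNIV \<and> (\<forall>v. (\<lambda>z. p' z v) \<in> cpoly)"
    using p cpoly_differential by blast
  then obtain p' where p': "\<And>a. complex_differential (p a) (p' a) UNIV" "\<And>a v. (\<lambda>z. p' a z v) \<in> cpoly"
    by metis
  have bnd': "\<exists>e>0. \<exists>M. summable M \<and> (\<forall>a. 0 \<le> M a) \<and> ball q e \<subseteq> \<Omega> \<and>
      (\<forall>a. \<forall>y\<in>ball q e. \<forall>v. cmod (p' a y v) \<le> M a * norm v)" if q: "q \<in> \<Omega>" for q
  proof -
    obtain e M where e: "e > 0" and M: "summable M" "\<And>a y. y \<in> ball q e \<Longrightarrow> cmod (p a y) \<le> M a"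
      using bnd[OF q] by blast
    obtain e' where e': "e' > 0" "ball q e' \<subseteq> \<Omega>" using \<Omega> q openE by blast
    have "cmod (p' a y v) \<le> (4 * M a / e) * norm v" if "y \<in> ball q (min (e/2) e')" for a y v
      using complex_differential_cauchy_bound[OF p'(1) e M(2)] that by auto
    moreover have "summable (\<lambda>a. 4 * M a / e)" using M(1) by (intro summable_divide summable_mult)
    moreover have "0 \<le> 4 * M a / e" for a
      using M(2)[of q a] e norm_ge_zero[of "p a q"] by (auto intro!: divide_nonneg_pos simp del: norm_ge_zero)
    ultimately show ?thesis using e e'
      by (intro exI[of _ "min (e/2) e'"]) (auto intro!: exI[of _ "\<lambda>a. 4 * M a / e"])
  qed
  have sm: "summable (\<lambda>a. p' a z v)" if "z \<in> \<Omega>" for z v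
  proof -
    from bnd'[OF that] obtain e M where "e > 0" and M: "summable M"
      and le: "\<forall>a. \<forall>y\<in>ball z e. \<forall>v. cmod (p' a y v) \<le> M a * norm v"
      by blast
    show ?thesis
    proof (rule summable_comparison_test')
      show "summable (\<lambda>a. M a * norm v)" by (rule summable_mult2[OF M])
      show "norm (p' a z v) \<le> M a * norm v" if "a \<ge> 0" for a using le \<open>e > 0\<close> by simp
    qed
  qed
  define F' where "F' z v = (\<Sum>a. p' a z v)" for z v
  have "(F has_derivative F' q) (at q)" if q: "q \<in> \<Omega>" for q
  proof -
    obtain e M where e: "e > 0" and M: "summable M" "\<And>a. 0 \<le> M a" and sub: "ball q e \<subseteq> \<Omega>"
      and pM: "\<And>a y v. y \<in> ball q e \<Longrightarrow> cmod (p' a y v) \<le> M a * norm v"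
      using bnd'[OF q] by blast
    have "\<exists>g. \<forall>x\<in>ball q e. (\<lambda>n. p n x) sums g x \<and> (g has_derivative F' x) (at x within ball q e)"
    proof (rule has_derivative_series)
      show "convex (ball q e)" by (rule convex_ball)
      show "(p n has_derivative p' n x) (at x within ball q e)" for n x
        using p'(1) by (auto simp: complex_differential_def intro: has_derivative_at_withinI)
      show "q \<in> ball q e" using e by simp
      show "(\<lambda>n. p n q) sums F q" using sums q by blast
      fix \<epsilon> :: real assume \<epsilon>: "\<epsilon> > 0"
      \<comment> \<open>The tail of the majorant series bounds the remainder of the differentiated
        series, uniformly in \<open>x\<close> and in proportion to \<open>norm h\<close>.\<close>
      have "(\<lambda>n. suminf M - sum M {..<n}) \<longlonglongrightarrow> suminf M - suminf M"
        by (intro tendsto_diff tendsto_const summable_LIMSEQ M)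
      then have "\<forall>\<^sub>F n in sequentially. suminf M - sum M {..<n} < \<epsilon>"
        using \<epsilon> by (intro order_tendstoD(2)) auto
      then show "\<forall>\<^sub>F n in sequentially. \<forall>x\<in>ball q e. \<forall>h. norm ((\<Sum>i<n. p' i x h) - F' x h) \<le> \<epsilon> * norm h"
      proof eventually_elim
        case (elim n)
        show ?case
        proof (intro ballI allI)
          fix x h assume x: "x \<in> ball q e"
          then have smx: "summable (\<lambda>a. p' a x h)" using sm sub by blast
          have sM: "summable (\<lambda>a. M (a + n) * norm h)"
            by (intro summable_mult2 summable_ignore_initial_segment M)
          have "norm ((\<Sum>i<n. p' i x h) - F' x h) = norm (\<Sum>i. p' (i + n) x h)"
            unfolding F'_def using suminf_minus_initial_segment[OF smx, of n] by (simp add: norm_minus_commute)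
          also have "\<dots> \<le> (\<Sum>i. M (i + n) * norm h)"
            by (rule norm_suminf_le[OF _ sM]) (use pM x in auto)
          also have "\<dots> = (suminf M - sum M {..<n}) * norm h"
            using suminf_minus_initial_segment[OF M(1), of n] M(1)
            by (simp add: suminf_mult2[symmetric] summable_ignore_initial_segment)
          also have "\<dots> \<le> \<epsilon> * norm h" using elim by (intro mult_right_mono) auto
          finally show "norm ((\<Sum>i<n. p' i x h) - F' x h) \<le> \<epsilon> * norm h" .
        qed
      qed
    qed
    then obtain g where g: "\<And>x. x \<in> ball q e \<Longrightarrow> (\<lambda>n. p n x) sums g x"
      "\<And>x. x \<in> ball q e \<Longrightarrow> (g has_derivative F' x) (at x within ball q e)" by blast
    \<comment> \<open>The series theorem provides only some limit function \<open>g\<close>;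
      uniqueness of sums identifies it with \<open>F\<close>.\<close>
    have "g x = F x" if "x \<in> ball q e" for x
      using g(1)[OF that] sums[of x] sub that by (meson subsetD sums_unique2)
    moreover have "(g has_derivative F' q) (at q)"
      using g(2)[of q] e at_within_open[of q "ball q e"] by simp
    ultimately show ?thesis
      by (intro has_derivative_transform_within_open[of g _ q UNIV "ball q e" F]) (use e in auto)
  qed
  moreover have "F' z (t *s v) = t * F' z v" if "z \<in> \<Omega>" for z t v
    using sm[OF that] p'(1) by (simp add: F'_def complex_differential_def suminf_mult)
  ultimately have "complex_differential F F' \<Omega>" by (simp add: complex_differential_def)
  moreover have "normal_cpoly_sum_on \<Omega> (\<lambda>z. F' z v)" for v
    unfolding normal_cpoly_sum_on_def
  proof (intro exI[of _ "\<lambda>a z. p' a z v"] conjI allI ballI)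
    show "(\<lambda>z. p' a z v) \<in> cpoly" for a by (rule p')
    show "(\<lambda>a. p' a y v) sums F' y v" if "y \<in> \<Omega>" for y
      unfolding F'_def using sm[OF that] by (rule summable_sums)
    fix q assume "q \<in> \<Omega>"
    from bnd'[OF this] obtain e M where "e > 0" "summable M" "\<forall>a. \<forall>y\<in>ball q e. \<forall>v. cmod (p' a y v) \<le> M a * norm v"
      by blast
    then show "\<exists>e>0. \<exists>M. summable M \<and> (\<forall>a. \<forall>y\<in>ball q e. cmod (p' a y v) \<le> M a)"
      using summable_mult2[of M "norm v"]
      by (intro exI[of _ e] conjI exI[of _ "\<lambda>a. M a * norm v"]) simp_all
  qed
  ultimately show ?thesis by blast
qed

section \<open>Derivatives of all orders and the identity principle\<close>

lemma normal_cpoly_sum_on_frechet: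
  assumes \<Omega>: "open \<Omega>" and F: "normal_cpoly_sum_on \<Omega> F"
  shows "complex_differential F (\<lambda>z. frechet_derivative F (at z)) \<Omega>"
    and "normal_cpoly_sum_on \<Omega> (\<lambda>z. frechet_derivative F (at z) v)"
proof -
  obtain F' where F': "complex_differential F F' \<Omega>" "\<And>v. normal_cpoly_sum_on \<Omega> (\<lambda>z. F' z v)"
    using normal_cpoly_sum_on_differential[OF assms] by blast
  have eq: "frechet_derivative F (at z) = F' z" if "z \<in> \<Omega>" for z
    using F'(1) that frechet_derivative_at by (fastforce simp: complex_differential_def)
  show "complex_differential F (\<lambda>z. frechet_derivative F (at z)) \<Omega>"
    using F'(1) eq by (simp add: complex_differential_def)
  show "normal_cpoly_sum_on \<Omega> (\<lambda>z. frechet_derivative F (at z) v)"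
    by (rule normal_cpoly_sum_on_cong[OF F'(2)]) (simp add: eq)
qed

text \<open>The head of the list is the direction differentiated last; dropping it leaves the
  derivative of one order less that is being differentiated.\<close>

fun iterated_derivative :: "(complex ^ 'm) list \<Rightarrow> (complex ^ 'm \<Rightarrow> complex) \<Rightarrow> complex ^ 'm \<Rightarrow> complex" where
  "iterated_derivative [] F = F"
| "iterated_derivative (v # vs) F = (\<lambda>z. frechet_derivative (iterated_derivative vs F) (at z) v)"

lemma normal_cpoly_sum_on_iterated:
  "open \<Omega> \<Longrightarrow> normal_cpoly_sum_on \<Omega> F \<Longrightarrow> normal_cpoly_sum_on \<Omega> (iterated_derivative vs F)"
  by (induction vs) (auto intro: normal_cpoly_sum_on_frechet)

text \<open>On the complex line through \<open>x\<close> in direction \<open>v\<close> these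
  derivatives are the derivatives at \<open>0\<close> of a one-variable holomorphic function. Its
  disc has radius \<open>e / norm v > 1\<close>, so it contains the parameter \<open>1\<close> of
  the point \<open>x + v\<close>.\<close>

lemma normal_cpoly_sum_on_identity:
  assumes \<Omega>: "open \<Omega>" and F: "normal_cpoly_sum_on \<Omega> F" and x: "ball x e \<subseteq> \<Omega>"
    and zero: "\<And>k. iterated_derivative (replicate k v) F x = 0" and v: "norm v < e"
  shows "F (x + v) = 0"
proof (cases "v = 0")
  case True
  then show ?thesis using zero[of 0] by simp
next
  case False
  define B where "B = ball (0::complex) (e / norm v)"
  define \<phi> where "\<phi> k t = iterated_derivative (replicate k v) F (x + t *s v)" for k t
  have inx: "x + t *s v \<in> \<Omega>" if "t \<in> B" for t
  proof -
    have "norm (t *s v) < e" using that False by (simp add: B_def norm_vector_scalar_mult field_simps)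
    then show ?thesis using x by (auto simp: dist_norm subset_iff)
  qed
  have d: "(\<phi> k has_field_derivative \<phi> (Suc k) t) (at t)" if "t \<in> B" for k t
    unfolding \<phi>_def
    using complex_differential_line[OF normal_cpoly_sum_on_frechet(1)[OF \<Omega>
        normal_cpoly_sum_on_iterated[OF \<Omega> F, of "replicate k v"]] inx[OF that]]
    by simp
  have it: "(deriv ^^ k) (\<phi> 0) t = \<phi> k t" if "t \<in> B" for k t
    using that
  proof (induction k arbitrary: t)
    case (Suc k)
    have "\<forall>\<^sub>F s in nhds t. (deriv ^^ k) (\<phi> 0) s = \<phi> k s"
      using Suc by (auto simp: eventually_nhds B_def intro!: exI[of _ B])
    then have "deriv ((deriv ^^ k) (\<phi> 0)) t = deriv (\<phi> k) t" by (rule deriv_cong_ev) simp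
    then show ?case using d[OF Suc.prems, of k] by (simp add: DERIV_imp_deriv)
  qed simp
  have "\<phi> 0 holomorphic_on B"
    using d unfolding holomorphic_on_def field_differentiable_def
    by (meson has_field_derivative_at_within)
  then have "\<phi> 0 1 = 0"
    unfolding B_def
  proof (rule holomorphic_fun_eq_0_on_ball)
    have "0 < e" using v norm_ge_zero[of v] by linarith
    then have 0: "0 \<in> B" using False by (simp add: B_def)
    show "(deriv ^^ k) (\<phi> 0) 0 = 0" for k
      using it[OF 0] zero by (simp add: \<phi>_def)
    show "(1::complex) \<in> ball 0 (e / norm v)" using v False by simp
  qed
  then show ?thesis by (simp add: \<phi>_def)
qed

text \<open>Here \<open>\<iota>\<close> is only real linear, which allows restriction to a real
  subspace. Continuity of the derivative is checked on basis vectors, where it is again a normal sum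
  and hence differentiable.\<close>

lemma normal_cpoly_sum_on_C1:
  assumes \<Omega>: "open \<Omega>" and F: "normal_cpoly_sum_on \<Omega> F"
    and \<iota>: "bounded_linear \<iota>" and U: "\<iota> ` U \<subseteq> \<Omega>"
  shows "has_C1_derivative_on (\<lambda>z. F (\<iota> z))
           (\<lambda>z. Blinfun (\<lambda>v. frechet_derivative F (at (\<iota> z)) (\<iota> v))) (U :: 'a::euclidean_space set)"
proof -
  define D where "D z = Blinfun (\<lambda>v. frechet_derivative F (at (\<iota> z)) (\<iota> v))" for z
  have dF: "(F has_derivative frechet_derivative F (at (\<iota> z))) (at (\<iota> z))" if "z \<in> U" for z
    using normal_cpoly_sum_on_frechet(1)[OF \<Omega> F] U that by (auto simp: complex_differential_def)
  have D: "blinfun_apply (D z) = (\<lambda>v. frechet_derivative F (at (\<iota> z)) (\<iota> v))" if "z \<in> U" for z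
    unfolding D_def
    using bounded_linear_compose[OF has_derivative_bounded_linear[OF dF[OF that]] \<iota>]
    by (simp add: bounded_linear_Blinfun_apply)
  have "continuous_on U D"
  proof (rule continuous_on_blinfun_componentwise)
    fix i :: 'a
    have "continuous_on \<Omega> (\<lambda>u. frechet_derivative F (at u) (\<iota> i))"
      using normal_cpoly_sum_on_frechet(1)[OF \<Omega> normal_cpoly_sum_on_frechet(2)[OF \<Omega> F, of "\<iota> i"]]
      unfolding complex_differential_def
      by (meson continuous_at_imp_continuous_on has_derivative_continuous)
    then have "continuous_on U (\<lambda>z. frechet_derivative F (at (\<iota> z)) (\<iota> i))"
      by (rule continuous_on_compose2[OF _ linear_continuous_on[OF \<iota>] U])
    then show "continuous_on U (\<lambda>z. D z i)"
      by (rule continuous_on_eq) (simp add: D)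
  qed
  moreover have "((\<lambda>z. F (\<iota> z)) has_derivative blinfun_apply (D z)) (at z)" if "z \<in> U" for z
    unfolding D[OF that]
    by (rule has_derivative_compose[OF bounded_linear_imp_has_derivative[OF \<iota>] dF[OF that]])
  ultimately show ?thesis by (simp add: has_C1_derivative_on_def D_def)
qed

text \<open>The real-linear embedding of the n-dimensional space as a totally real subspace of twice
  the complex dimension. A mixed power series is the pullback of an ordinary power series.\<close>

definition with_conjugate :: "complex ^ 'n \<Rightarrow> complex ^ ('n + 'n)" where
  "with_conjugate z = (\<chi> k. case k of Inl i \<Rightarrow> z $ i | Inr i \<Rightarrow> cnj (z $ i))"

lemma with_conjugate_nth [simp]:
  "with_conjugate z $ Inl i = z $ i" "with_conjugate z $ Inr i = cnj (z $ i)"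
  by (simp_all add: with_conjugate_def)

lemma bounded_linear_with_conjugate: "bounded_linear with_conjugate"
proof -
  have "linear with_conjugate"
    by (rule linearI) (auto simp: vec_eq_iff with_conjugate_def split: sum.split)
  then show ?thesis by (simp add: linear_conv_bounded_linear)
qed

text \<open>Summability of complex families is absolute, and the size of a monomial depends only on
  the moduli of the coordinates. Convergence at one point \<open>z\<close> therefore gives a common
  majorant on the whole open polydisc \<open>P z\<close>.\<close>

lemma mixed_function_lift:
  fixes U :: "(complex ^ 'n) set"
  assumes "mixed_function U f"
  obtains \<Omega> F where "open \<Omega>" "with_conjugate ` U \<subseteq> \<Omega>" "normal_cpoly_sum_on \<Omega> F"
    "\<And>z. z \<in> U \<Longrightarrow> f z = F (with_conjugate z)"
proof -
  obtain c where U: "open U" and c: "\<And>z. z \<in> U \<Longrightarrow>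
      ((\<lambda>(\<nu>, \<mu>). c \<nu> \<mu> * (\<Prod>i\<in>UNIV. (z $ i) ^ \<nu> i) * (\<Prod>i\<in>UNIV. (cnj (z $ i)) ^ \<mu> i)) has_sum f z) UNIV"
    using assms unfolding mixed_function_def by blast
  define P where "P z = {u :: complex ^ ('n + 'n).
      \<forall>i. cmod (u $ Inl i) < cmod (z $ i) \<and> cmod (u $ Inr i) < cmod (z $ i)}" for z :: "complex ^ 'n"
  define \<Omega> where "\<Omega> = (\<Union>z\<in>U. P z)"
  have openP: "open (P z)" for z
  proof -
    have "P z = (\<Inter>i\<in>UNIV. {u. cmod (u $ Inl i) < cmod (z $ i)} \<inter> {u. cmod (u $ Inr i) < cmod (z $ i)})"
      by (auto simp: P_def)
    also have "open \<dots>"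
      by (intro open_INT open_Int open_Collect_less continuous_intros ballI) auto
    finally show ?thesis .
  qed
  have "open \<Omega>" unfolding \<Omega>_def using openP by blast
  \<comment> \<open>The pairs of multi-indices are enumerated so that the unordered sum becomes a
    series.\<close>
  define b :: "nat \<Rightarrow> ('n \<Rightarrow> nat) \<times> ('n \<Rightarrow> nat)" where "b = from_nat_into UNIV"
  have bij: "bij_betw b UNIV UNIV"
  proof -
    have "inj (\<lambda>n::nat. ((\<lambda>_::'n. n), (\<lambda>_::'n. n)))" by (rule injI) (auto dest: fun_cong)
    then have "infinite (UNIV :: (('n \<Rightarrow> nat) \<times> ('n \<Rightarrow> nat)) set)"
      using finite_imageD[of _ "UNIV :: nat set"] finite_subset[OF subset_UNIV] infinite_UNIV_nat by blast
    then show ?thesis unfolding b_def by (intro bij_betw_from_nat_into) auto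
  qed
  define p where "p a u = (case b a of (\<nu>, \<mu>) \<Rightarrow>
      c \<nu> \<mu> * (\<Prod>i\<in>UNIV. (u $ Inl i) ^ \<nu> i) * (\<Prod>i\<in>UNIV. (u $ Inr i) ^ \<mu> i))" for a u
  have has_sum: "((\<lambda>a. p a (with_conjugate z)) has_sum f z) UNIV" if "z \<in> U" for z
    using has_sum_reindex_bij_betw[OF bij, THEN iffD2, OF c[OF that]]
    unfolding p_def with_conjugate_nth by (simp add: case_prod_unfold)
  then have sum_f: "(\<lambda>a. p a (with_conjugate z)) sums f z" if "z \<in> U" for z
    using has_sum_imp_sums that by blast
  have abs: "summable (\<lambda>a. cmod (p a (with_conjugate z)))" if "z \<in> U" for z
  proof -
    have "(\<lambda>a. cmod (p a (with_conjugate z))) summable_on UNIV"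
      using has_sum_imp_summable[OF has_sum[OF that]] by (simp add: summable_on_iff_abs_summable_on_complex)
    then show ?thesis by (rule summable_on_imp_summable)
  qed
  have le: "cmod (p a u) \<le> cmod (p a (with_conjugate z))" if "u \<in> P z" for a u z
  proof -
    obtain \<nu> \<mu> where ba: "b a = (\<nu>, \<mu>)" by fastforce
    have "cmod (u $ Inl i) \<le> cmod (z $ i)" "cmod (u $ Inr i) \<le> cmod (z $ i)" for i
      using that by (auto simp: P_def less_imp_le)
    then show ?thesis
      unfolding p_def ba
      by (auto simp: norm_mult prod_norm[symmetric] norm_power
        intro!: mult_mono prod_mono power_mono prod_nonneg mult_nonneg_nonneg)
  qed
  have sub: "with_conjugate ` U \<subseteq> \<Omega>"
  proof
    fix u assume "u \<in> with_conjugate ` U"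
    then obtain z where z: "z \<in> U" "u = with_conjugate z" by blast
    \<comment> \<open>The polydisc of \<open>z\<close> is open and misses the point over
      \<open>z\<close>. Pushing every coordinate radially outward by a small \<open>t\<close> stays
      in the open set \<open>U\<close> and strictly increases all moduli, so the polydisc of the new
      point works.\<close>
    define \<sigma> where "\<sigma> = (\<chi> i. if z $ i = 0 then 1 else sgn (z $ i))"
    have "\<forall>\<^sub>F t in at_right (0::real). z + t *\<^sub>R \<sigma> \<in> U"
    proof -
      have "((\<lambda>t::real. z + t *\<^sub>R \<sigma>) \<longlongrightarrow> z + 0 *\<^sub>R \<sigma>) (at_right 0)"
        by (intro tendsto_intros)
      then show ?thesis using topological_tendstoD U z by fastforce
    qed
    then obtain t where t: "t > 0" "z + t *\<^sub>R \<sigma> \<in> U"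
      using eventually_at_right_less[of "0::real"] by (metis (mono_tags, lifting) eventually_conj_iff eventually_happens trivial_limit_at_right_real)
    have big: "cmod (z $ i) < cmod ((z + t *\<^sub>R \<sigma>) $ i)" for i
    proof (cases "z $ i = 0")
      case False
      have "(z + t *\<^sub>R \<sigma>) $ i = z $ i + t *\<^sub>R sgn (z $ i)"
        using False by (simp add: \<sigma>_def)
      also have "\<dots> = complex_of_real (1 + t / cmod (z $ i)) * z $ i"
        using False by (simp add: sgn_div_norm scaleR_conv_of_real field_simps)
      finally have "(z + t *\<^sub>R \<sigma>) $ i = complex_of_real (1 + t / cmod (z $ i)) * z $ i" .
      then have "cmod ((z + t *\<^sub>R \<sigma>) $ i) = (1 + t / cmod (z $ i)) * cmod (z $ i)"
        using t by (simp only: norm_mult norm_of_real) simp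
      also have "\<dots> = cmod (z $ i) + t" using False by (simp add: field_simps)
      finally show ?thesis using t by simp
    qed (use t in \<open>simp add: \<sigma>_def\<close>)
    then have "u \<in> P (z + t *\<^sub>R \<sigma>)" using z by (simp add: P_def)
    then show "u \<in> \<Omega>" using t by (auto simp: \<Omega>_def)
  qed
  define F where "F u = (\<Sum>a. p a u)" for u
  have "normal_cpoly_sum_on \<Omega> F"
    unfolding normal_cpoly_sum_on_def
  proof (intro exI[of _ p] conjI allI ballI)
    show "p a \<in> cpoly" for a
    proof -
      obtain \<nu> \<mu> where ba: "b a = (\<nu>, \<mu>)" by fastforce
      show ?thesis unfolding p_def ba
        by (auto intro!: cpoly.mult cpoly.const cpoly_prod cpoly_power cpoly.coord)
    qed
  next
    fix q assume "q \<in> \<Omega>"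
    then obtain z where z: "z \<in> U" "q \<in> P z" by (auto simp: \<Omega>_def)
    then obtain e where e: "e > 0" "ball q e \<subseteq> P z" using openP openE by blast
    then show "\<exists>e>0. \<exists>M. summable M \<and> (\<forall>a. \<forall>y\<in>ball q e. cmod (p a y) \<le> M a)"
      using abs[OF z(1)] le by blast
  next
    fix y assume "y \<in> \<Omega>"
    then obtain z where z: "z \<in> U" "y \<in> P z" by (auto simp: \<Omega>_def)
    have "summable (\<lambda>a. p a y)"
      by (rule summable_comparison_test'[OF abs[OF z(1)], of 0]) (use le z in auto)
    then show "(\<lambda>a. p a y) sums F y" unfolding F_def by (rule summable_sums)
  qed
  moreover have "f z = F (with_conjugate z)" if "z \<in> U" for z
    using sum_f[OF that] by (simp add: F_def sums_iff)
  ultimately show ?thesis by (intro that[OF \<open>open \<Omega>\<close> sub])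
qed

subsection \<open>Analytic sets of codimension two do not separate\<close>

lemma C1_submanifold_open:
  assumes "open (M :: 'a::euclidean_space set)"
  shows "C1_submanifold DIM('a) M"
proof -
  have "C1_on M (\<lambda>x. x)"
    unfolding C1_on_def by (intro exI[of _ "\<lambda>_. id_blinfun"]) (auto simp: continuous_on_const)
  moreover have "homeomorphism M M (\<lambda>x. x) (\<lambda>x. x)"
    by (simp add: homeomorphism_def)
  ultimately show ?thesis unfolding C1_submanifold_def
    by (intro ballI exI[of _ M] exI[of _ "\<lambda>x. x"] exI[of _ UNIV]) (use assms in auto)
qed

text \<open>Two open sides of \<open>G - V\<close> have closures that cover \<open>G\<close>,
  because \<open>V\<close> has no interior. Their common boundary in \<open>G\<close> is nonempty as
  \<open>G\<close> is connected, and both sides come arbitrarily close to each of its points, so it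
  also separates locally.\<close>

lemma separator_of_dense_open:
  fixes G V :: "'a::metric_space set"
  assumes G: "open G" "connected G" and V: "open (G - V)"
    and dense: "\<And>W. open W \<Longrightarrow> W \<noteq> {} \<Longrightarrow> W \<subseteq> G \<Longrightarrow> \<not> W \<subseteq> V"
    and ncon: "\<not> connected (G - V)"
  obtains S where "S \<noteq> {}" "S \<subseteq> G \<inter> V" 
    "\<And>N. open N \<Longrightarrow> N \<subseteq> G \<Longrightarrow> N \<inter> S \<noteq> {} \<Longrightarrow> \<not> connected (N - S)"
proof -
  from ncon obtain A0 C0 where AC0: "open A0" "open C0" "A0 \<inter> (G - V) \<noteq> {}" "C0 \<inter> (G - V) \<noteq> {}"
    "A0 \<inter> C0 \<inter> (G - V) = {}" "G - V \<subseteq> A0 \<union> C0"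
    unfolding connected_def by blast
  define A where "A = A0 \<inter> (G - V)"
  define C where "C = C0 \<inter> (G - V)"
  have AC: "open A" "open C" "A \<noteq> {}" "C \<noteq> {}" "A \<inter> C = {}" "A \<union> C = G - V"
    using AC0 V by (auto simp: A_def C_def)
  define S where "S = closure A \<inter> closure C \<inter> G"
  have disj: "A \<inter> closure C = {}" "closure A \<inter> C = {}"
    using open_Int_closure_eq_empty[OF AC(1), of C] open_Int_closure_eq_empty[OF AC(2), of A] AC(5) by auto
  have SV: "S \<subseteq> G \<inter> V"
    using disj AC(6) by (auto simp: S_def)
  have cover: "G \<subseteq> closure A \<union> closure C"
  proof
    fix x assume x: "x \<in> G"
    show "x \<in> closure A \<union> closure C"
    proof (rule ccontr)
      assume "x \<notin> closure A \<union> closure C"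
      then have "G - closure A - closure C \<noteq> {}" using x by auto
      moreover have "open (G - closure A - closure C)" using G by (intro open_Diff) auto
      ultimately have "\<not> (G - closure A - closure C \<subseteq> V)" by (intro dense) auto
      then show False using AC(6) closure_subset[of A] closure_subset[of C] by auto
    qed
  qed
  have "S \<noteq> {}"
  proof
    assume "S = {}"
    then have "closure A \<inter> G = {} \<or> closure C \<inter> G = {}"
      using cover by (intro connected_closedD[OF G(2)]) (auto simp: S_def)
    then show False using AC(3,4,6) closure_subset[of A] closure_subset[of C] by blast
  qed
  moreover have "\<not> connected (N - S)" if N: "open N" "N \<subseteq> G" "N \<inter> S \<noteq> {}" for N
  proof
    assume con: "connected (N - S)"
    have "closure A \<inter> (N - S) = {} \<or> closure C \<inter> (N - S) = {}"
      using cover N(2) by (intro connected_closedD[OF con]) (auto simp: S_def)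
    moreover have "N \<inter> A \<noteq> {}" "N \<inter> C \<noteq> {}"
      using N(3) open_Int_closure_eq_empty[OF N(1)] unfolding S_def by auto
    moreover have "A \<inter> S = {}" "C \<inter> S = {}" using disj by (auto simp: S_def)
    ultimately show False using closure_subset[of A] closure_subset[of C] by auto
  qed
  ultimately show ?thesis using that[OF _ SV] by blast
qed

text \<open>The sides \<open>h > 0\<close> and \<open>h < 0\<close> are connected, and both
  accumulate at every zero of \<open>h\<close> since \<open>h\<close> is open. The zero
  \<open>y\<close> outside \<open>S\<close> joins them, and all other points of \<open>N - S\<close>
  lie in the closure of what is joined.\<close>

lemma connected_minus_part_of_hypersurface:
  fixes h :: "'a::euclidean_space \<Rightarrow> real"
  assumes con: "\<And>I. convex I \<Longrightarrow> connected (N \<inter> h -` I)"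
    and opn: "\<And>y W. y \<in> N \<Longrightarrow> open W \<Longrightarrow> y \<in> W \<Longrightarrow> \<exists>e>0. \<forall>c\<in>ball (h y) e. \<exists>z\<in>N \<inter> W. h z = c"
    and S: "\<And>z. z \<in> S \<inter> N \<Longrightarrow> h z = 0" and y: "y \<in> N" "h y = 0" "y \<notin> S"
  shows "connected (N - S)"
proof -
  define P where "P = N \<inter> h -` {0<..}"
  define Q where "Q = N \<inter> h -` {..<0}"
  have clP: "z \<in> closure P" if z: "z \<in> N" "h z = 0" for z
  proof (rule ccontr)
    assume "z \<notin> closure P"
    then obtain e where e: "e > 0" "\<forall>c\<in>ball (h z) e. \<exists>z\<in>N \<inter> - closure P. h z = c"
      using opn[OF z(1) open_Compl[OF closed_closure], of P] by auto
    moreover have "e/2 \<in> ball (h z) e" using e z by simp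
    ultimately obtain u where "u \<in> N" "u \<notin> closure P" "h u = e/2" by blast
    then show False using e closure_subset[of P] by (auto simp: P_def)
  qed
  have clQ: "z \<in> closure Q" if z: "z \<in> N" "h z = 0" for z
  proof (rule ccontr)
    assume "z \<notin> closure Q"
    then obtain e where e: "e > 0" "\<forall>c\<in>ball (h z) e. \<exists>z\<in>N \<inter> - closure Q. h z = c"
      using opn[OF z(1) open_Compl[OF closed_closure], of Q] by auto
    moreover have "-e/2 \<in> ball (h z) e" using e z by simp
    ultimately obtain u where "u \<in> N" "u \<notin> closure Q" "h u = -e/2" by blast
    then show False using e closure_subset[of Q] by (auto simp: Q_def)
  qed
  have "connected P" "connected Q" unfolding P_def Q_def by (auto intro!: con)
  have "connected (insert y P)"
    by (rule connected_intermediate_closure[OF \<open>connected P\<close>]) (use clP[OF y(1,2)] closure_subset in auto)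
  moreover have "connected (insert y Q)"
    by (rule connected_intermediate_closure[OF \<open>connected Q\<close>]) (use clQ[OF y(1,2)] closure_subset in auto)
  ultimately have "connected (insert y P \<union> insert y Q)" by (rule connected_Un) auto
  moreover have "insert y P \<union> insert y Q \<subseteq> N - S"
    using S y by (auto simp: P_def Q_def)
  moreover have "N - S \<subseteq> closure (insert y P \<union> insert y Q)"
  proof
    fix z assume z: "z \<in> N - S"
    consider "h z > 0" | "h z < 0" | "h z = 0" by linarith
    then have "z \<in> P \<union> Q \<union> closure P" using z clP by cases (auto simp: P_def Q_def)
    then show "z \<in> closure (insert y P \<union> insert y Q)"
      using closure_subset[of P] closure_subset[of Q] by (auto simp: closure_Un closure_insert)
  qed
  ultimately show ?thesis by (rule connected_intermediate_closure)
qed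

text \<open>
  If the zero set separates, let \<open>S\<close> be the part common to the boundaries of two sides and take a point
  of \<open>S\<close> where \<open>f\<close> vanishes to least order. A derivative of the next lower order vanishes on \<open>S\<close> with
  nonzero differential there, so \<open>S\<close> lies in a hypersurface, and it fills that hypersurface since
  it separates.
\<close>

lemma connected_complement_analytic_zeros:
  fixes \<iota> :: "'a::euclidean_space \<Rightarrow> complex ^ 'm"
  assumes \<Omega>: "open \<Omega>" and F: "normal_cpoly_sum_on \<Omega> F" and \<iota>: "bounded_linear \<iota>"
    and G: "open G" "connected G" "\<iota> ` G \<subseteq> \<Omega>"
    and dims: "\<And>d M. M \<noteq> {} \<Longrightarrow> M \<subseteq> {z\<in>G. F (\<iota> z) = 0} \<Longrightarrow> C1_submanifold d M \<Longrightarrow> d < DIM('a) - 1"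
  shows "connected (G - {z. F (\<iota> z) = 0})"
proof (rule ccontr)
  define V where "V = {z. F (\<iota> z) = 0}"
  assume "\<not> connected (G - {z. F (\<iota> z) = 0})"
  then have ncon: "\<not> connected (G - V)" by (simp add: V_def)
  have "continuous_on G (\<lambda>z. F (\<iota> z))"
    using normal_cpoly_sum_on_C1[OF \<Omega> F \<iota> G(3)] by (rule has_C1_derivative_on_imp_continuous_on)
  then have "open (G \<inter> (\<lambda>z. F (\<iota> z)) -` (- {0}))"
    by (intro continuous_open_preimage G) auto
  moreover have "G \<inter> (\<lambda>z. F (\<iota> z)) -` (- {0}) = G - V" by (auto simp: V_def)
  ultimately have oGV: "open (G - V)" by simp
  have dense: "\<not> W \<subseteq> V" if "open W" "W \<noteq> {}" "W \<subseteq> G" for W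
  proof
    assume "W \<subseteq> V"
    then have "DIM('a) < DIM('a) - 1" using that by (intro dims[OF _ _ C1_submanifold_open[of W]]) (auto simp: V_def)
    then show False by simp
  qed
  obtain S where S: "S \<noteq> {}" "S \<subseteq> G \<inter> V"
    "\<And>N. open N \<Longrightarrow> N \<subseteq> G \<Longrightarrow> N \<inter> S \<noteq> {} \<Longrightarrow> \<not> connected (N - S)"
    using separator_of_dense_open[OF G(1,2) oGV dense ncon] by blast
  define Q where "Q n \<longleftrightarrow> (\<exists>x\<in>S. \<exists>vs. length vs = n \<and> set vs \<subseteq> range \<iota> \<and> iterated_derivative vs F (\<iota> x) \<noteq> 0)" for n
  \<comment> \<open>If all these derivatives vanished, the identity principle on the lines through
    \<open>\<iota> x\<close> and \<open>\<iota> z\<close> would put a whole neighbourhood of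
    \<open>x\<close> into \<open>V\<close>, against \<open>dense\<close>.\<close>
  have "\<exists>n. Q n"
  proof (rule ccontr)
    assume "\<nexists>n. Q n"
    then have zero: "iterated_derivative vs F (\<iota> x) = 0" if "x \<in> S" "set vs \<subseteq> range \<iota>" for x vs
      using that unfolding Q_def by blast
    obtain x where x: "x \<in> S" "x \<in> G" using S(1,2) by blast
    then obtain e where e: "e > 0" "ball (\<iota> x) e \<subseteq> \<Omega>" using \<Omega> G(3) openE by blast
    define W where "W = G \<inter> {z. norm (\<iota> (z - x)) < e}"
    have "open W" unfolding W_def
      by (intro open_Int G open_Collect_less continuous_intros bounded_linear.continuous_on[OF \<iota>])
    moreover have "x \<in> W" using x e by (simp add: W_def linear_0 bounded_linear.linear[OF \<iota>])
    moreover have "W \<subseteq> V"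
    proof
      fix z assume z: "z \<in> W"
      have "F (\<iota> x + \<iota> (z - x)) = 0"
      proof (rule normal_cpoly_sum_on_identity[OF \<Omega> F e(2)])
        show "iterated_derivative (replicate k (\<iota> (z - x))) F (\<iota> x) = 0" for k
          by (rule zero[OF x(1)]) auto
        show "norm (\<iota> (z - x)) < e" using z by (simp add: W_def)
      qed
      moreover have "\<iota> x + \<iota> (z - x) = \<iota> z"
        by (simp add: linear_diff bounded_linear.linear[OF \<iota>])
      ultimately show "z \<in> V" by (simp add: V_def)
    qed
    ultimately show False using dense[of W] W_def by blast
  qed
  then obtain n where n: "Q n" "\<And>k. k < n \<Longrightarrow> \<not> Q k" using exists_least_iff[of Q] by blast
  then obtain x vs where x: "x \<in> S" and vs: "length vs = n" "set vs \<subseteq> range \<iota>" "iterated_derivative vs F (\<iota> x) \<noteq> 0"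
    unfolding Q_def by blast
  \<comment> \<open>Order zero is excluded because \<open>S\<close> consists of zeros. Removing the
    head of \<open>vs\<close> leaves a derivative that vanishes on all of \<open>S\<close> by
    minimality of \<open>n\<close>.\<close>
  have "vs \<noteq> []" using vs(3) x S(2) by (auto simp: V_def)
  then obtain v0 ws where vsw: "vs = \<iota> v0 # ws" using vs(2) by (cases vs) auto
  define H where "H = iterated_derivative ws F"
  have HS: "H (\<iota> y) = 0" if "y \<in> S" for y
    using n(2)[of "length ws"] vs that unfolding Q_def vsw H_def by auto
  define val where "val = frechet_derivative H (at (\<iota> x)) (\<iota> v0)"
  have val: "val \<noteq> 0" using vs(3) by (simp add: vsw val_def H_def)
  have "normal_cpoly_sum_on \<Omega> H" unfolding H_def by (rule normal_cpoly_sum_on_iterated[OF \<Omega> F])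
  define D where "D z = Blinfun (\<lambda>v. frechet_derivative H (at (\<iota> z)) (\<iota> v))" for z
  have xG: "x \<in> G" using x S(2) by blast
  have D: "has_C1_derivative_on (\<lambda>z. H (\<iota> z)) D G"
    unfolding D_def by (rule normal_cpoly_sum_on_C1[OF \<Omega> \<open>normal_cpoly_sum_on \<Omega> H\<close> \<iota> G(3)])
  \<comment> \<open>Pairing with \<open>val\<close> turns the complex-valued \<open>H\<close> into a
    real function whose derivative at \<open>x\<close> along \<open>v0\<close> is
    \<open>val \<bullet> val\<close>, hence nonzero.\<close>
  define h where "h z = val \<bullet> H (\<iota> z)" for z
  define Dh where "Dh z = blinfun_inner_right val o\<^sub>L D z" for z
  have Dh: "has_C1_derivative_on h Dh G"
    using D unfolding has_C1_derivative_on_def h_def Dh_def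
    by (auto intro!: derivative_eq_intros continuous_intros bounded_bilinear.continuous_on[OF bounded_bilinear_blinfun_compose])
  have Dx: "D x v0 = val"
  proof -
    have "(H has_derivative frechet_derivative H (at (\<iota> x))) (at (\<iota> x))"
      using normal_cpoly_sum_on_frechet(1)[OF \<Omega> \<open>normal_cpoly_sum_on \<Omega> H\<close>] xG G(3)
      by (auto simp: complex_differential_def)
    from bounded_linear_compose[OF has_derivative_bounded_linear[OF this] \<iota>]
    show ?thesis unfolding D_def val_def by (simp add: bounded_linear_Blinfun_apply)
  qed
  have sur: "surj (blinfun_apply (Dh x))"
  proof (rule surjI)
    fix c
    show "Dh x ((c / (val \<bullet> val)) *\<^sub>R v0) = c"
      using val Dx by (simp add: Dh_def blinfun.scaleR_right)
  qed
  obtain N where N: "open N" "x \<in> N" "N \<subseteq> G"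
    and con: "\<And>C. convex C \<Longrightarrow> connected (N \<inter> h -` C)"
    and opn: "\<And>y W. y \<in> N \<Longrightarrow> open W \<Longrightarrow> y \<in> W \<Longrightarrow> \<exists>e>0. \<forall>c\<in>ball (h y) e. \<exists>z\<in>N \<inter> W. h z = c"
    and sm: "C1_submanifold (dim {v. Dh x v = 0}) (N \<inter> h -` {0})"
    by (rule submersion_local_structure[OF G(1) xG Dh sur]) (rule that; assumption)
  have hS: "h z = 0" if "z \<in> S \<inter> N" for z using HS that by (simp add: h_def)
  have "N \<inter> h -` {0} \<subseteq> S"
  proof
    fix y assume y: "y \<in> N \<inter> h -` {0}"
    show "y \<in> S"
    proof (rule ccontr)
      assume "y \<notin> S"
      then have "connected (N - S)"
        using connected_minus_part_of_hypersurface[of N h S y] con opn hS y by blast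
      then show False using S(3)[OF N(1,3)] N(2) x by blast
    qed
  qed
  then have "dim {v. Dh x v = 0} < DIM('a) - 1"
    using S(2) N(2) x hS by (intro dims[OF _ _ sm]) (auto simp: V_def)
  then show False using dim_kernel_functional[OF sur] by simp
qed

lemma submanifold_dim_le_real_dimension:
  fixes M :: "'a::euclidean_space set"
  assumes "M \<noteq> {}" "M \<subseteq> V" "C1_submanifold d M"
  shows "d \<le> real_dimension V"
  unfolding real_dimension_def
proof (rule Max_ge)
  \<comment> \<open>\<open>Max\<close> is meaningful only on a finite set. A point of
    \<open>M\<close> supplies the subspace that bounds \<open>d\<close>.\<close>
  have "d \<le> DIM('a)" if "M \<noteq> {}" "C1_submanifold d M" for d and M :: "'a set"
    using that unfolding C1_submanifold_def by (metis all_not_in_conv dim_subset_UNIV)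
  then show "finite {d. \<exists>M. M \<noteq> {} \<and> M \<subseteq> V \<and> C1_submanifold d M}"
    by (intro finite_subset[OF _ finite_atMost[of "DIM('a)"]]) auto
qed (use assms in blast)

subsection \<open>Fibres in balls\<close>

text \<open>Unlike \<open>at l within S\<close>, this filter keeps the point \<open>l\<close>
  itself, as the hypothesis \<open>refl\<close> of \<open>section_component_locally_clopen\<close>
  demands.\<close>

lemma eventually_within_incl:
  "eventually Q (inf (nhds l) (principal S)) \<longleftrightarrow> (\<exists>T. open T \<and> l \<in> T \<and> (\<forall>x\<in>T \<inter> S. Q x))"
  by (auto simp: eventually_inf_principal eventually_nhds)

lemma connected_locally_constant:
  assumes "connected S" "a \<in> S" "b \<in> S" "P a"
    and "\<And>x. x \<in> S \<Longrightarrow> \<forall>\<^sub>F y in inf (nhds x) (principal S). P y \<longleftrightarrow> P x"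
  shows "P b"
proof (rule connected_induction_simple[where P = P, OF assms(1-4)])
  fix x assume "x \<in> S"
  from assms(5)[OF this] obtain T where T: "open T" "x \<in> T" "\<forall>y\<in>T \<inter> S. P y \<longleftrightarrow> P x"
    unfolding eventually_within_incl by blast
  have "openin (top_of_set S) (S \<inter> T)" by (rule openin_open_Int[OF T(1)])
  then show "\<exists>T. openin (top_of_set S) T \<and> x \<in> T \<and> (\<forall>y\<in>T. \<forall>z\<in>T. P y \<longrightarrow> P z)"
    using \<open>x \<in> S\<close> T(2,3) by blast
qed

lemma connected_if_eq_component_containing:
  assumes "K \<subseteq> component_containing K P" "P \<noteq> {}"
  shows "connected K"
proof -
  obtain x where x: "x \<in> P" using assms by blast
  have "K = \<Union>{C. connected C \<and> C \<subseteq> K \<and> P \<subseteq> C}"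
  proof
    show "K \<subseteq> \<Union>{C. connected C \<and> C \<subseteq> K \<and> P \<subseteq> C}"
    proof
      fix z assume "z \<in> K"
      then have "z \<in> component_containing K P" using assms(1) by auto
      then obtain C where "connected C" "C \<subseteq> K" "P \<subseteq> C" "z \<in> C"
        unfolding component_containing_def by auto
      then show "z \<in> \<Union>{C. connected C \<and> C \<subseteq> K \<and> P \<subseteq> C}" by auto
    qed
  qed auto
  moreover have "connected (\<Union>{C. connected C \<and> C \<subseteq> K \<and> P \<subseteq> C})"
    using x by (intro connected_Union) auto
  ultimately show ?thesis by simp
qed

text \<open>Value and radius form a single parameter, so that both can be varied in one
  family.\<close>

definition ball_fiber :: "('a::euclidean_space \<Rightarrow> complex) \<Rightarrow> complex \<times> real \<Rightarrow> 'a set" where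
  "ball_fiber f l = {z \<in> cball 0 (snd l). f z = fst l}"

text \<open>The squared norm is smooth everywhere and has the same spheres as the norm as level
  sets.\<close>

definition with_norm2 :: "('a::euclidean_space \<Rightarrow> complex) \<Rightarrow> 'a \<Rightarrow> complex \<times> real" where
  "with_norm2 f z = (f z, z \<bullet> z)"

lemma with_norm2_C1:
  assumes "has_C1_derivative_on f D U"
  obtains D2 where "has_C1_derivative_on (with_norm2 f) D2 U"
    "\<And>z v. z \<in> U \<Longrightarrow> blinfun_apply (D2 z) v = (D z v, 2 * (z \<bullet> v))"
proof -
  define D2 where "D2 z = Blinfun (\<lambda>v. (D z v, 2 * (z \<bullet> v)))" for z
  have "bounded_linear (\<lambda>v. (D z v, 2 * (z \<bullet> v)))" for z
    by (intro bounded_linear_Pair blinfun.bounded_linear_right bounded_linear_const_mult bounded_linear_inner_right)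
  then have D2: "blinfun_apply (D2 z) v = (D z v, 2 * (z \<bullet> v))" for z v
    by (simp add: D2_def bounded_linear_Blinfun_apply)
  have "continuous_on U D2"
  proof (rule continuous_on_blinfun_componentwise)
    fix i :: 'a
    have 1: "continuous_on U (\<lambda>z. blinfun_apply (D z) i)"
      using assms unfolding has_C1_derivative_on_def
      by (intro bounded_bilinear.continuous_on[OF bounded_bilinear_blinfun_apply] continuous_on_const) blast
    have 2: "continuous_on U (\<lambda>z. 2 * (z \<bullet> i))" by (intro continuous_intros)
    show "continuous_on U (\<lambda>z. blinfun_apply (D2 z) i)"
      unfolding D2 by (rule continuous_on_Pair[OF 1 2])
  qed
  moreover have "(with_norm2 f has_derivative blinfun_apply (D2 z)) (at z)" if "z \<in> U" for z
  proof -
    have "(with_norm2 f has_derivative (\<lambda>v. (D z v, z \<bullet> v + v \<bullet> z))) (at z)"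
      unfolding with_norm2_def using assms that unfolding has_C1_derivative_on_def
      by (intro has_derivative_Pair has_derivative_inner has_derivative_ident) auto
    moreover have "(\<lambda>v. (D z v, z \<bullet> v + v \<bullet> z)) = blinfun_apply (D2 z)"
      by (auto simp: D2 inner_commute)
    ultimately show ?thesis by simp
  qed
  ultimately have "has_C1_derivative_on (with_norm2 f) D2 U" by (simp add: has_C1_derivative_on_def)
  then show ?thesis using that D2 by blast
qed

locale C1_on_ball =
  fixes f :: "'a::euclidean_space \<Rightarrow> complex" and D U and R :: real
  assumes openU: "open U" and ball_subset: "cball 0 R \<subseteq> U" and C1: "has_C1_derivative_on f D U"
begin

definition regular :: "'a \<Rightarrow> bool" where
  "regular p \<longleftrightarrow> surj (blinfun_apply (D p))"

text \<open>Transversality to the sphere in the form that the pair of \<open>f\<close> and the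
  squared norm is a submersion at \<open>p\<close>, so that the local structure of submersions
  applies to it.\<close>

definition transverse :: "'a \<Rightarrow> bool" where
  "transverse p \<longleftrightarrow> surj (\<lambda>v. (D p v, 2 * (p \<bullet> v)))"

lemma cont_f: "continuous_on U f"
  using C1 by (rule has_C1_derivative_on_imp_continuous_on)

lemma regular_local_structure:
  assumes p: "p \<in> U" "regular p" and G: "open G" "p \<in> G"
  obtains N where "open N" "p \<in> N" "N \<subseteq> G" "N \<subseteq> U"
    "\<And>C. convex C \<Longrightarrow> connected (N \<inter> f -` C)"
    "\<And>y W. y \<in> N \<Longrightarrow> open W \<Longrightarrow> y \<in> W \<Longrightarrow> \<exists>e>0. \<forall>c\<in>ball (f y) e. \<exists>z\<in>N \<inter> W. f z = c"
proof -
  have op: "open (G \<inter> U)" and pin: "p \<in> G \<inter> U" using G p openU by auto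
  have C1': "has_C1_derivative_on f D (G \<inter> U)" by (rule has_C1_derivative_on_subset[OF C1]) simp
  obtain N where N: "open N" "p \<in> N" "N \<subseteq> G \<inter> U"
    "\<And>C. convex C \<Longrightarrow> connected (N \<inter> f -` C)"
    "\<And>y W. y \<in> N \<Longrightarrow> open W \<Longrightarrow> y \<in> W \<Longrightarrow> \<exists>e>0. \<forall>c\<in>ball (f y) e. \<exists>z\<in>N \<inter> W. f z = c"
    by (rule submersion_local_structure[OF op pin C1' p(2)[unfolded regular_def]]) (rule that; assumption)
  show ?thesis by (rule that[OF N(1,2) _ _ N(4,5)]) (use N(3) in auto)
qed

lemma transverse_local_structure:
  assumes p: "p \<in> U" "transverse p" and G: "open G" "p \<in> G"
  obtains N where "open N" "p \<in> N" "N \<subseteq> G" "N \<subseteq> U"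
    "\<And>C. convex C \<Longrightarrow> connected (N \<inter> with_norm2 f -` C)"
    "\<exists>e>0. \<forall>c\<in>ball (with_norm2 f p) e. \<exists>z\<in>N. with_norm2 f z = c"
proof -
  obtain D2 where D2: "has_C1_derivative_on (with_norm2 f) D2 U"
    "\<And>z v. z \<in> U \<Longrightarrow> blinfun_apply (D2 z) v = (D z v, 2 * (z \<bullet> v))"
    by (rule with_norm2_C1[OF C1]) (rule that; assumption)
  have op: "open (G \<inter> U)" and pin: "p \<in> G \<inter> U" using G p openU by auto
  have C1': "has_C1_derivative_on (with_norm2 f) D2 (G \<inter> U)"
    by (rule has_C1_derivative_on_subset[OF D2(1)]) simp
  have "blinfun_apply (D2 p) = (\<lambda>v. (D p v, 2 * (p \<bullet> v)))" using D2(2) p by auto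
  then have sur: "surj (blinfun_apply (D2 p))" using p(2) by (simp add: transverse_def)
  obtain N where N: "open N" "p \<in> N" "N \<subseteq> G \<inter> U"
    "\<And>C. convex C \<Longrightarrow> connected (N \<inter> with_norm2 f -` C)"
    "\<And>y W. y \<in> N \<Longrightarrow> open W \<Longrightarrow> y \<in> W \<Longrightarrow> \<exists>e>0. \<forall>c\<in>ball (with_norm2 f y) e. \<exists>z\<in>N \<inter> W. with_norm2 f z = c"
    by (rule submersion_local_structure[OF op pin C1' sur]) (rule that; assumption)
  have "\<exists>e>0. \<forall>c\<in>ball (with_norm2 f p) e. \<exists>z\<in>N. with_norm2 f z = c"
    using N(5)[OF N(2) open_UNIV UNIV_I] by auto
  then show ?thesis by (intro that[OF N(1,2) _ _ N(4)]) (use N(3) in auto)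
qed

lemma compact_ball_fiber:
  assumes "snd l \<le> R"
  shows "compact (ball_fiber f l)"
proof -
  have "closed (cball 0 (snd l) \<inter> f -` {fst l})"
    using assms ball_subset
    by (intro continuous_closed_preimage continuous_on_subset[OF cont_f]) auto
  moreover have "ball_fiber f l = cball 0 (snd l) \<inter> f -` {fst l}"
    by (auto simp: ball_fiber_def)
  ultimately show ?thesis
    by (metis bounded_cball bounded_subset compact_eq_bounded_closed inf_le1)
qed

text \<open>The parameters whose fibre meets the complement of \<open>G\<close> are the pairs
  \<open>(f z, norm z)\<close>, for \<open>z\<close> in a compact set, with the radius raised
  arbitrarily. A compact set plus a closed ray is closed.\<close>

lemma ball_fiber_upper_semicontinuous:
  assumes G: "open G" "ball_fiber f l \<subseteq> G" and l: "snd l \<le> R"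
  shows "\<forall>\<^sub>F m in inf (nhds l) (principal (UNIV \<times> {..R})). ball_fiber f m \<subseteq> G"
proof -
  define X where "X = cball 0 R - G"
  define B where "B = (\<Union>x\<in>(\<lambda>z. (f z, norm z)) ` X. \<Union>y\<in>{0::complex} \<times> {0::real..}. {x + y})"
  have B: "m \<in> B \<longleftrightarrow> (\<exists>z\<in>X. f z = fst m \<and> norm z \<le> snd m)" for m
  proof
    assume "m \<in> B"
    then show "\<exists>z\<in>X. f z = fst m \<and> norm z \<le> snd m" by (auto simp: B_def)
  next
    assume "\<exists>z\<in>X. f z = fst m \<and> norm z \<le> snd m"
    then obtain z where z: "z \<in> X" "f z = fst m" "norm z \<le> snd m" by blast
    have "m = (f z, norm z) + (0, snd m - norm z)" using z by (simp add: prod_eq_iff)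
    moreover have "(f z, norm z) \<in> (\<lambda>z. (f z, norm z)) ` X" using z by blast
    moreover have "(0, snd m - norm z) \<in> {0::complex} \<times> {0::real..}" using z by simp
    ultimately show "m \<in> B" unfolding B_def by blast
  qed
  have "compact X" unfolding X_def using G by (intro compact_diff) auto
  then have "compact ((\<lambda>z. (f z, norm z)) ` X)"
    using ball_subset X_def
    by (intro compact_continuous_image continuous_intros continuous_on_subset[OF cont_f]) auto
  then have "closed B" unfolding B_def
    by (intro compact_closed_sums closed_Times) auto
  moreover have "l \<notin> B"
    using G(2) by (auto simp: B X_def ball_fiber_def)
  ultimately have "\<forall>\<^sub>F m in nhds l. m \<in> - B"
    by (intro eventually_nhds_in_open) auto
  then show ?thesis unfolding eventually_inf_principal
  proof (rule eventually_mono, intro impI subsetI)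
    fix m z assume m: "m \<in> - B" "m \<in> UNIV \<times> {..R}" and z: "z \<in> ball_fiber f m"
    have "norm z \<le> snd m" "f z = fst m" using z by (auto simp: ball_fiber_def)
    moreover from this m(2) have "norm z \<le> R" by auto
    moreover have "z \<notin> X" using B[of m] m(1) calculation(1,2) by blast
    ultimately show "z \<in> G" by (auto simp: X_def)
  qed
qed

text \<open>Inside the ball the fibre is locally a fibre of \<open>f\<close>. At the boundary sphere
  it is the preimage, under the pair of \<open>f\<close> and the squared norm, of a point times a
  half-line; this is convex, so both cases fall under the local structure of submersions.\<close>

lemma ball_fiber_locally_trivial:
  assumes l: "l \<in> \<Lambda>" and \<Lambda>: "\<Lambda> \<subseteq> UNIV \<times> {0<..R}"
    and reg: "\<And>p. p \<in> ball_fiber f l \<Longrightarrow> regular p"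
    and trv: "\<And>p. p \<in> ball_fiber f l \<Longrightarrow> norm p = snd l \<Longrightarrow> transverse p"
  shows "locally_trivial_pi0 (inf (nhds l) (principal \<Lambda>)) (ball_fiber f) (ball_fiber f l)"
    (is "locally_trivial_pi0 ?F _ _")
proof -
  have s: "0 < snd l" "snd l \<le> R" using l \<Lambda> by auto
  have \<Lambda>': "\<Lambda> \<subseteq> UNIV \<times> {..R}" using \<Lambda> by force
  have nb: "eventually Q ?F" if "eventually Q (nhds l)" for Q
    using that by (rule filter_leD[rotated]) simp
  have inL: "\<forall>\<^sub>F m in ?F. m \<in> \<Lambda>" by (simp add: eventually_inf_principal)
  have upper: "\<forall>\<^sub>F m in ?F. ball_fiber f m \<subseteq> G" if "open G" "ball_fiber f l \<subseteq> G" for G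
    using ball_fiber_upper_semicontinuous[OF that s(2)]
    by (rule filter_leD[rotated]) (intro inf_mono order_refl, simp add: \<Lambda>')
  have local: "\<exists>N. open N \<and> p \<in> N \<and> N \<subseteq> G \<and>
        (\<forall>\<^sub>F m in ?F. connected (N \<inter> ball_fiber f m) \<and> N \<inter> ball_fiber f m \<noteq> {})"
    if p: "p \<in> ball_fiber f l" and G: "open G" "p \<in> G" for p G
  proof -
    have fp: "f p = fst l" "norm p \<le> snd l" using p by (auto simp: ball_fiber_def)
    have pU: "p \<in> U" using fp s ball_subset by auto
    show ?thesis
    proof (cases "norm p < snd l")
      case True
      \<comment> \<open>The room between \<open>s'\<close> and \<open>snd l\<close> keeps the window
        inside the ball for all nearby radii.\<close>
      then obtain s' where s': "norm p < s'" "s' < snd l" using dense by blast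
      have "open (G \<inter> ball 0 s')" "p \<in> G \<inter> ball 0 s'" using G s' by auto
      then obtain N where N: "open N" "p \<in> N" "N \<subseteq> G \<inter> ball 0 s'"
        and con: "\<And>C. convex C \<Longrightarrow> connected (N \<inter> f -` C)"
        and opn: "\<And>y W. y \<in> N \<Longrightarrow> open W \<Longrightarrow> y \<in> W \<Longrightarrow> \<exists>e>0. \<forall>c\<in>ball (f y) e. \<exists>z\<in>N \<inter> W. f z = c"
        by (rule regular_local_structure[OF pU reg[OF p]]) (rule that; assumption)
      obtain e where e: "e > 0" "\<forall>c\<in>ball (f p) e. \<exists>z\<in>N. f z = c"
        using opn[OF N(2) open_UNIV UNIV_I] by auto
      have "\<forall>\<^sub>F m in nhds l. snd m > s'"
        by (rule order_tendstoD(1)[OF tendsto_snd[OF filterlim_ident]]) (rule s')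
      moreover have "\<forall>\<^sub>F m in nhds l. fst m \<in> ball (f p) e"
        by (rule topological_tendstoD[OF tendsto_fst[OF filterlim_ident]]) (use e fp in auto)
      ultimately have "\<forall>\<^sub>F m in nhds l. connected (N \<inter> ball_fiber f m) \<and> N \<inter> ball_fiber f m \<noteq> {}"
      proof eventually_elim
        case (elim m)
        have eq: "N \<inter> ball_fiber f m = N \<inter> f -` {fst m}"
          using N(3) elim(1) by (force simp: ball_fiber_def)
        have "\<exists>z\<in>N. f z = fst m" using e(2) elim(2) by blast
        then show ?case unfolding eq using con[of "{fst m}"] by auto
      qed
      then have "\<forall>\<^sub>F m in ?F. connected (N \<inter> ball_fiber f m) \<and> N \<inter> ball_fiber f m \<noteq> {}" by (rule nb)
      then show ?thesis using N by blast
    next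
      case False
      then have np: "norm p = snd l" using fp by simp
      obtain N where N: "open N" "p \<in> N" "N \<subseteq> G" "N \<subseteq> U"
        and con: "\<And>C. convex C \<Longrightarrow> connected (N \<inter> with_norm2 f -` C)"
        and opn: "\<exists>e>0. \<forall>c\<in>ball (with_norm2 f p) e. \<exists>z\<in>N. with_norm2 f z = c"
        by (rule transverse_local_structure[OF pU trv[OF p np] G]) (rule that; assumption)
      obtain e where e: "e > 0" "\<forall>c\<in>ball (with_norm2 f p) e. \<exists>z\<in>N. with_norm2 f z = c"
        using opn by blast
      have lim: "((\<lambda>m. (fst m, (snd m)\<^sup>2)) \<longlongrightarrow> (fst l, (snd l)\<^sup>2)) (nhds l)"
        by (intro tendsto_intros filterlim_ident)
      have "(fst l, (snd l)\<^sup>2) \<in> ball (with_norm2 f p) e"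
        using e fp np by (simp add: with_norm2_def power2_norm_eq_inner[symmetric])
      then have "\<forall>\<^sub>F m in nhds l. (fst m, (snd m)\<^sup>2) \<in> ball (with_norm2 f p) e"
        by (rule topological_tendstoD[OF lim open_ball])
      then have "\<forall>\<^sub>F m in ?F. (fst m, (snd m)\<^sup>2) \<in> ball (with_norm2 f p) e" by (rule nb)
      then have "\<forall>\<^sub>F m in ?F. connected (N \<inter> ball_fiber f m) \<and> N \<inter> ball_fiber f m \<noteq> {}"
        using inL
      proof eventually_elim
        case (elim m)
        have sm: "0 \<le> snd m" using elim(2) \<Lambda> by auto
        have iff: "norm z \<le> snd m \<longleftrightarrow> z \<bullet> z \<le> (snd m)\<^sup>2" for z :: 'a
          using sm by (simp add: power2_norm_eq_inner[symmetric] abs_le_square_iff[symmetric])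
        have eq: "N \<inter> ball_fiber f m = N \<inter> with_norm2 f -` ({fst m} \<times> {..(snd m)\<^sup>2})"
          by (auto simp: ball_fiber_def with_norm2_def iff)
        obtain z where "z \<in> N" "with_norm2 f z = (fst m, (snd m)\<^sup>2)" using e(2) elim(1) by blast
        then have "N \<inter> ball_fiber f m \<noteq> {}" unfolding eq by auto
        moreover have "connected (N \<inter> ball_fiber f m)"
          unfolding eq by (intro con convex_Times) auto
        ultimately show ?case by blast
      qed
      then show ?thesis using N by blast
    qed
  qed
  show ?thesis unfolding locally_trivial_pi0_def
    using compact_ball_fiber[OF s(2)] upper local by simp
qed

end

section \<open>The tube over a punctured disc and its fibres\<close>

definition punctured_cball :: "real \<Rightarrow> complex set" where
  "punctured_cball d = {\<eta>. 0 < cmod \<eta> \<and> cmod \<eta> \<le> d}"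

lemma connected_punctured_cball: "connected (punctured_cball d)"
  using connected_annulus(2)[of 0 "0::complex" d] by (simp add: punctured_cball_def)

context C1_on_ball
begin

text \<open>The Hamm-Le bound in terms of submersions. For \<open>\<rho> = R\<close> transversality
  is asked on the boundary sphere only.\<close>

definition milnor_regular :: "real \<Rightarrow> real \<Rightarrow> bool" where
  "milnor_regular \<rho> d \<longleftrightarrow> (\<forall>p\<in>cball 0 R. f p \<in> punctured_cball d \<longrightarrow>
     regular p \<and> (\<rho> \<le> norm p \<longrightarrow> transverse p))"

definition tube :: "real \<Rightarrow> 'a set" where
  "tube d = {z \<in> cball 0 R. f z \<in> punctured_cball d}"

lemma milnor_regular_mono: "milnor_regular \<rho> d \<Longrightarrow> d' \<le> d \<Longrightarrow> milnor_regular \<rho> d'"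
  unfolding milnor_regular_def punctured_cball_def by auto

lemma milnor_family_locally_trivial:
  assumes reg: "milnor_regular \<rho> d" and \<rho>: "0 < \<rho>"
    and \<Lambda>: "\<Lambda> \<subseteq> punctured_cball d \<times> {\<rho>..R}" and l: "l \<in> \<Lambda>"
  shows "locally_trivial_pi0 (inf (nhds l) (principal \<Lambda>)) (ball_fiber f) (ball_fiber f l)"
proof (rule ball_fiber_locally_trivial[OF l])
  show "\<Lambda> \<subseteq> UNIV \<times> {0<..R}" using \<Lambda> \<rho> by force
  have "fst l \<in> punctured_cball d" "\<rho> \<le> snd l" "snd l \<le> R" using l \<Lambda> by auto
  then show "regular p" "norm p = snd l \<Longrightarrow> transverse p" if "p \<in> ball_fiber f l" for p
    using that reg unfolding milnor_regular_def ball_fiber_def by auto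
qed

lemma milnor_fibers_connected_if_one:
  assumes reg: "milnor_regular \<rho> d" and \<rho>: "0 < \<rho>"
    and l: "l \<in> punctured_cball d \<times> {\<rho>..R}" "connected (ball_fiber f l)"
    and m: "m \<in> punctured_cball d \<times> {\<rho>..R}"
  shows "connected (ball_fiber f m)"
proof (rule connected_locally_constant[where P = "\<lambda>l. connected (ball_fiber f l)", OF _ l(1) m l(2)])
  show "connected (punctured_cball d \<times> {\<rho>..R})"
    by (intro connected_Times connected_punctured_cball) simp
  fix x assume x: "x \<in> punctured_cball d \<times> {\<rho>..R}"
  note lt = milnor_family_locally_trivial[OF reg \<rho> order_refl x]
  show "\<forall>\<^sub>F y in inf (nhds x) (principal (punctured_cball d \<times> {\<rho>..R})).
          connected (ball_fiber f y) \<longleftrightarrow> connected (ball_fiber f x)"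
    using eventually_connected[OF lt] eventually_not_connected[OF lt]
    by (cases "connected (ball_fiber f x)") simp_all
qed

text \<open>Meeting \<open>G\<close> persists for nearby values by lower semicontinuity; missing
  \<open>G\<close> means lying in \<open>H\<close>, which persists by upper semicontinuity. The
  punctured disc is connected.\<close>

lemma clopen_part_of_tube_meets_all_fibers:
  assumes reg: "milnor_regular R d" and R: "0 < R"
    and GH: "open G" "open H" "tube d \<subseteq> G \<union> H" "tube d \<inter> G \<inter> H = {}" "tube d \<inter> G \<noteq> {}"
    and \<eta>: "\<eta> \<in> punctured_cball d"
  shows "ball_fiber f (\<eta>, R) \<inter> G \<noteq> {}"
proof -
  let ?\<Lambda> = "punctured_cball d \<times> {R}"
  have sub: "ball_fiber f l \<subseteq> tube d" if "l \<in> ?\<Lambda>" for l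
    using that by (auto simp: ball_fiber_def tube_def)
  obtain z where z: "z \<in> tube d" "z \<in> G" using GH(5) by auto
  have 0: "(f z, R) \<in> ?\<Lambda>" and 1: "ball_fiber f (f z, R) \<inter> G \<noteq> {}"
    using z by (auto simp: tube_def ball_fiber_def)
  show ?thesis
  proof (rule connected_locally_constant[where P = "\<lambda>l. ball_fiber f l \<inter> G \<noteq> {}", OF _ 0 _ 1])
    show "connected ?\<Lambda>" by (intro connected_Times connected_punctured_cball) simp
    show "(\<eta>, R) \<in> ?\<Lambda>" using \<eta> by simp
    fix x assume x: "x \<in> ?\<Lambda>"
    have "?\<Lambda> \<subseteq> punctured_cball d \<times> {R..R}" by auto
    note lt = milnor_family_locally_trivial[OF reg R this x]
    show "\<forall>\<^sub>F y in inf (nhds x) (principal ?\<Lambda>). (ball_fiber f y \<inter> G \<noteq> {}) = (ball_fiber f x \<inter> G \<noteq> {})"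
    proof (cases "ball_fiber f x \<inter> G = {}")
      case True
      then have "ball_fiber f x \<subseteq> H" using sub[OF x] GH(3) by auto
      from ltp_upper[OF lt GH(2) this]
      have "\<forall>\<^sub>F y in inf (nhds x) (principal ?\<Lambda>). ball_fiber f y \<subseteq> H \<and> y \<in> ?\<Lambda>"
        by (auto simp: eventually_inf_principal elim: eventually_mono)
      then show ?thesis
      proof (rule eventually_mono)
        fix y assume "ball_fiber f y \<subseteq> H \<and> y \<in> ?\<Lambda>"
        then have "ball_fiber f y \<inter> G = {}" using sub[of y] GH(4) by auto
        then show "(ball_fiber f y \<inter> G \<noteq> {}) = (ball_fiber f x \<inter> G \<noteq> {})" using True by simp
      qed
    next
      case False
      then have "\<forall>\<^sub>F y in inf (nhds x) (principal ?\<Lambda>). G \<inter> ball_fiber f y \<noteq> {}"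
        by (intro ltp_lower[OF lt GH(1)]) auto
      then show ?thesis using False by (auto simp: Int_commute elim: eventually_mono)
    qed
  qed
qed

text \<open>A point of smallest norm on a fibre cannot lie where the fibre is transverse to spheres.\<close>

lemma clopen_part_of_tube_meets_small_ball:
  assumes reg: "milnor_regular R d" "milnor_regular \<rho> d'" and R: "0 < R" and d: "0 < d" "0 < d'"
    and GH: "open G" "open H" "tube d \<subseteq> G \<union> H" "tube d \<inter> G \<inter> H = {}" "tube d \<inter> G \<noteq> {}"
  shows "G \<inter> (ball 0 \<rho> - {z. f z = 0}) \<noteq> {}"
proof -
  define \<eta> where "\<eta> = complex_of_real (min d d')"
  have \<eta>: "\<eta> \<in> punctured_cball d" "\<eta> \<in> punctured_cball d'" using d by (auto simp: \<eta>_def punctured_cball_def)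
  define Y where "Y = ball_fiber f (\<eta>, R) \<inter> G"
  have Yt: "ball_fiber f (\<eta>, R) \<subseteq> tube d" using \<eta> by (auto simp: ball_fiber_def tube_def)
  have "Y = ball_fiber f (\<eta>, R) - H" using Yt GH(3,4) by (auto simp: Y_def)
  \<comment> \<open>Being the fibre minus the open set \<open>H\<close>, the part in
    \<open>G\<close> is compact and has a point of least norm.\<close>
  then have "compact Y" using compact_ball_fiber[of "(\<eta>, R)"] GH(2) by (simp add: compact_diff)
  moreover have "Y \<noteq> {}" unfolding Y_def
    by (rule clopen_part_of_tube_meets_all_fibers[OF reg(1) R GH \<eta>(1)])
  ultimately obtain p where p: "p \<in> Y" "\<And>q. q \<in> Y \<Longrightarrow> norm p \<le> norm q"
    using continuous_attains_inf[of Y norm] continuous_on_norm_id by blast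
  have pY: "p \<in> cball 0 R" "f p = \<eta>" "p \<in> G" using p by (auto simp: Y_def ball_fiber_def)
  have "norm p < \<rho>"
  proof (rule ccontr)
    assume "\<not> norm p < \<rho>"
    then have "transverse p" using reg(2) pY \<eta> unfolding milnor_regular_def by auto
    moreover have "p \<in> U" using pY ball_subset by auto
    ultimately obtain N e where N: "N \<subseteq> G" and e: "e > 0" "\<forall>c\<in>ball (with_norm2 f p) e. \<exists>z\<in>N. with_norm2 f z = c"
      using transverse_local_structure[OF _ _ GH(1) pY(3)] by metis
    \<comment> \<open>The submersion attains every nearby pair, in particular the same value of
      \<open>f\<close> with a smaller squared norm.\<close>
    have "(\<eta>, p \<bullet> p - e/2) \<in> ball (with_norm2 f p) e"
      using e pY by (simp add: with_norm2_def dist_Pair_Pair dist_real_def)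
    then obtain z where z: "z \<in> N" "with_norm2 f z = (\<eta>, p \<bullet> p - e/2)" using e(2) by blast
    then have fz: "f z = \<eta>" and "z \<bullet> z < p \<bullet> p" using e(1) by (auto simp: with_norm2_def)
    then have lt: "norm z < norm p" by (simp add: norm_lt)
    then have "z \<in> Y" using fz z(1) N pY(1) by (auto simp: Y_def ball_fiber_def)
    then show False using p(2) lt by force
  qed
  moreover have "f p \<noteq> 0" using pY(2) \<eta> by (auto simp: punctured_cball_def)
  ultimately show ?thesis using pY(3) by auto
qed

lemma connected_tube:
  assumes reg: "milnor_regular R d" "milnor_regular \<rho> d'" and R: "0 < R" and d: "0 < d" "0 < d'"
    and \<rho>: "\<rho> \<le> R" "\<And>z. z \<in> ball 0 \<rho> \<Longrightarrow> cmod (f z) \<le> d"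
    and con: "connected (ball 0 \<rho> - {z. f z = 0})"
  shows "connected (tube d)"
proof (rule connectedI)
  fix G H assume GH: "open G" "open H" "G \<inter> tube d \<noteq> {}" "H \<inter> tube d \<noteq> {}" "G \<inter> H \<inter> tube d = {}"
    "tube d \<subseteq> G \<union> H"
  let ?B = "ball 0 \<rho> - {z. f z = 0}"
  have "G \<inter> ?B \<noteq> {}"
    by (rule clopen_part_of_tube_meets_small_ball[OF reg R d GH(1,2)]) (use GH in auto)
  moreover have "H \<inter> ?B \<noteq> {}"
    by (rule clopen_part_of_tube_meets_small_ball[OF reg R d GH(2,1)]) (use GH in auto)
  moreover have "?B \<subseteq> tube d" using \<rho> by (auto simp: tube_def punctured_cball_def)
  ultimately show False using connectedD[OF con GH(1,2)] GH(5,6) by auto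
qed

text \<open>Near a regular zero \<open>w\<close> the fibres have connected pieces that vary continuously over a full
  disc around \<open>0\<close>; they single out one component of each fibre, and these components form a
  clopen subset of the tube.\<close>

lemma connected_small_fibers:
  assumes w: "norm w < R" "f w = 0" "regular w" and R: "0 < R" and d0: "0 < d0"
    and tubes: "\<And>d. 0 < d \<Longrightarrow> d \<le> d0 \<Longrightarrow> milnor_regular R d \<and> connected (tube d)"
  obtains d where "0 < d" "d \<le> d0" "\<And>\<eta>. \<eta> \<in> punctured_cball d \<Longrightarrow> connected (ball_fiber f (\<eta>, R))"
proof -
  have "w \<in> U" "w \<in> ball 0 R" using w ball_subset by auto
  then obtain N where N: "open N" "w \<in> N" "N \<subseteq> ball 0 R"
    and con: "\<And>C. convex C \<Longrightarrow> connected (N \<inter> f -` C)"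
    and opn: "\<And>y W. y \<in> N \<Longrightarrow> open W \<Longrightarrow> y \<in> W \<Longrightarrow> \<exists>e>0. \<forall>c\<in>ball (f y) e. \<exists>z\<in>N \<inter> W. f z = c"
    using regular_local_structure[OF _ w(3) open_ball] by metis
  obtain e where e: "e > 0" "\<forall>c\<in>ball (f w) e. \<exists>z\<in>N. f z = c"
    using opn[OF N(2) open_UNIV UNIV_I] by auto
  \<comment> \<open>Strictly below \<open>e\<close>, all values are attained by \<open>f\<close> on
    \<open>N\<close>, so every \<open>P l\<close> is nonempty.\<close>
  define d where "d = min d0 (e/2)"
  have d: "0 < d" "d \<le> d0" "d < e" using e d0 by (auto simp: d_def)
  note reg = tubes[OF d(1,2), THEN conjunct1] and con_tube = tubes[OF d(1,2), THEN conjunct2]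
  define P where "P l = N \<inter> f -` {fst l}" for l :: "complex \<times> real"
  let ?\<Lambda> = "punctured_cball d \<times> {R}"
  have P: "connected (P l)" "P l \<subseteq> ball_fiber f l" "P l \<noteq> {}" if "l \<in> ?\<Lambda>" for l
  proof -
    show "connected (P l)" unfolding P_def by (rule con) simp
    show "P l \<subseteq> ball_fiber f l" using N(3) that by (auto simp: P_def ball_fiber_def less_imp_le subset_iff)
    have "fst l \<in> ball (f w) e" using that d(3) w(2) by (auto simp: punctured_cball_def)
    then show "P l \<noteq> {}" using e(2) unfolding P_def by blast
  qed
  have loc: "\<exists>G H T. open G \<and> open H \<and> G \<inter> H = {} \<and> open T \<and> l \<in> T \<and>
      (\<forall>m\<in>T \<inter> ?\<Lambda>. ball_fiber f m \<subseteq> G \<union> H \<and> component_containing (ball_fiber f m) (P m) = ball_fiber f m \<inter> G)"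
    if l: "l \<in> ?\<Lambda>" for l
  proof -
    have "?\<Lambda> \<subseteq> punctured_cball d \<times> {R..R}" by auto
    note lt = milnor_family_locally_trivial[OF reg R this l]
    have refl: "Q l" if "eventually Q (inf (nhds l) (principal ?\<Lambda>))" for Q
      using that l unfolding eventually_within_incl by blast
    have ev: "\<forall>\<^sub>F m in inf (nhds l) (principal ?\<Lambda>). connected (P m) \<and> P m \<subseteq> ball_fiber f m"
      unfolding eventually_inf_principal using P by (intro always_eventually) blast
    \<comment> \<open>This uses openness of \<open>f\<close> at every point of \<open>N\<close>, not
      only at \<open>w\<close>.\<close>
    have lower: "\<forall>\<^sub>F m in inf (nhds l) (principal ?\<Lambda>). W \<inter> P m \<noteq> {}" if W: "open W" "W \<inter> P l \<noteq> {}" for W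
    proof -
      obtain y where y: "y \<in> W" "y \<in> N" "f y = fst l" using W(2) by (auto simp: P_def)
      from opn[OF y(2) W(1) y(1)] obtain e' where e': "e' > 0" "\<forall>c\<in>ball (f y) e'. \<exists>z\<in>N \<inter> W. f z = c" by blast
      have "\<forall>\<^sub>F m in nhds l. fst m \<in> ball (f y) e'"
        by (rule topological_tendstoD[OF tendsto_fst[OF filterlim_ident]]) (use e' y in auto)
      then have "\<forall>\<^sub>F m in nhds l. W \<inter> P m \<noteq> {}"
      proof (rule eventually_mono)
        fix m :: "complex \<times> real" assume "fst m \<in> ball (f y) e'"
        then obtain z where "z \<in> N \<inter> W" "f z = fst m" using e'(2) by blast
        then show "W \<inter> P m \<noteq> {}" by (auto simp: P_def)
      qed
      then show ?thesis unfolding eventually_inf_principal by (rule eventually_mono) simp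
    qed
    show ?thesis
    proof (rule section_component_locally_clopen[where K = "ball_fiber f" and P = P and l = l
          and F = "inf (nhds l) (principal ?\<Lambda>)"])
      fix G H assume GH: "open G" "open H" "G \<inter> H = {}"
        "\<forall>\<^sub>F m in inf (nhds l) (principal ?\<Lambda>).
           ball_fiber f m \<subseteq> G \<union> H \<and> component_containing (ball_fiber f m) (P m) = ball_fiber f m \<inter> G"
      obtain T where "open T" "l \<in> T" "\<forall>m\<in>T \<inter> ?\<Lambda>.
          ball_fiber f m \<subseteq> G \<union> H \<and> component_containing (ball_fiber f m) (P m) = ball_fiber f m \<inter> G"
        using GH(4) unfolding eventually_within_incl by (elim exE conjE)
      with GH(1-3) show ?thesis by (intro exI conjI)
    qed (fact lt, fact refl, fact ev, fact P(3)[OF l], fact lower)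
  qed
  \<comment> \<open>\<open>A z\<close> says that \<open>z\<close> lies in the marked component of
    its own fibre. It holds at one point and is locally constant on the connected tube.\<close>
  define A where "A z \<longleftrightarrow> z \<in> component_containing (ball_fiber f (f z, R)) (P (f z, R))" for z
  have A: "A z" if z: "z \<in> tube d" for z
  proof -
    have "complex_of_real d \<in> punctured_cball d" using d by (simp add: punctured_cball_def)
    then have l0: "(complex_of_real d, R) \<in> ?\<Lambda>" by simp
    then obtain x where x: "x \<in> P (complex_of_real d, R)" using P(3) by blast
    have fx: "f x = complex_of_real d" using x by (simp add: P_def)
    have Ax: "A x"
      unfolding A_def component_containing_def fx using P(1,2)[OF l0] x by blast
    have xt: "x \<in> tube d"
      using x P(2)[OF l0] l0 by (auto simp: tube_def ball_fiber_def)
    show ?thesis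
    proof (rule connected_locally_constant[where P = A, OF con_tube xt z Ax])
      fix y assume y: "y \<in> tube d"
      have yl: "(f y, R) \<in> ?\<Lambda>" using y by (simp add: tube_def)
      obtain G H T where GHT: "open G" "open H" "G \<inter> H = {}" "open T" "(f y, R) \<in> T"
        "\<And>m. m \<in> T \<inter> ?\<Lambda> \<Longrightarrow> ball_fiber f m \<subseteq> G \<union> H"
        "\<And>m. m \<in> T \<inter> ?\<Lambda> \<Longrightarrow> component_containing (ball_fiber f m) (P m) = ball_fiber f m \<inter> G"
        using loc[OF yl] by metis
      have key: "A v \<longleftrightarrow> v \<in> G" "v \<in> G \<union> H" if "v \<in> tube d" "(f v, R) \<in> T" for v
      proof -
        have m: "(f v, R) \<in> T \<inter> ?\<Lambda>" and v: "v \<in> ball_fiber f (f v, R)"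
          using that by (auto simp: tube_def ball_fiber_def)
        show "A v \<longleftrightarrow> v \<in> G" unfolding A_def GHT(7)[OF m] using v by simp
        show "v \<in> G \<union> H" using GHT(6)[OF m] v by auto
      qed
      \<comment> \<open>Near \<open>y\<close> the predicate \<open>A\<close> agrees with membership
        in \<open>G\<close>, so whichever of the disjoint sets contains \<open>y\<close> fixes its
        truth value.\<close>
      define W where "W = (if y \<in> G then G else H)"
      have W: "open W" "y \<in> W" using GHT(1,2) key(2)[OF y GHT(5)] by (auto simp: W_def)
      define T' where "T' = W \<inter> (U \<inter> (\<lambda>v. (f v, R)) -` T)"
      have "continuous_on U (\<lambda>v. (f v, R))" by (intro continuous_intros cont_f)
      then have "open T'" unfolding T'_def
        by (intro open_Int W continuous_open_preimage openU GHT)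
      moreover have "y \<in> T'" using W GHT(5) y ball_subset by (auto simp: T'_def tube_def)
      moreover have "A v \<longleftrightarrow> A y" if "v \<in> T' \<inter> tube d" for v
      proof -
        have v: "v \<in> tube d" "(f v, R) \<in> T" "v \<in> W" using that by (auto simp: T'_def)
        show ?thesis using key(1)[OF v(1,2)] key(1)[OF y GHT(5)] v(3) GHT(3) by (auto simp: W_def split: if_splits)
      qed
      ultimately show "\<forall>\<^sub>F v in inf (nhds y) (principal (tube d)). A v \<longleftrightarrow> A y"
        unfolding eventually_within_incl by blast
    qed
  qed
  show ?thesis
  proof (rule that[OF d(1,2)])
    fix \<eta> assume \<eta>: "\<eta> \<in> punctured_cball d"
    then have l: "(\<eta>, R) \<in> ?\<Lambda>" by simp
    have "ball_fiber f (\<eta>, R) \<subseteq> component_containing (ball_fiber f (\<eta>, R)) (P (\<eta>, R))"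
    proof
      fix z assume z: "z \<in> ball_fiber f (\<eta>, R)"
      then have "z \<in> tube d" "f z = \<eta>" using \<eta> by (auto simp: ball_fiber_def tube_def)
      then show "z \<in> component_containing (ball_fiber f (\<eta>, R)) (P (\<eta>, R))" using A[of z] by (simp add: A_def)
    qed
    then show "connected (ball_fiber f (\<eta>, R))" by (rule connected_if_eq_component_containing[OF _ P(3)[OF l]])
  qed
qed

end

text \<open>Splitting \<open>p\<close> itself gives a vector \<open>k\<close> in the kernel of
  \<open>T\<close> with \<open>p \<bullet> k = p \<bullet> p\<close>. Adding multiples of
  \<open>k\<close> adjusts the radial component freely and leaves \<open>T\<close>
  unchanged.\<close>

lemma surj_with_radial_part:
  fixes p :: "complex ^ 'n"
  assumes sur: "surj T" and T: "linear T" and p: "p \<noteq> 0"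
    and tr: "{u + v | u v. T u = 0 \<and> p \<bullet> v = 0} = UNIV"
  shows "surj (\<lambda>v. (T v, 2 * (p \<bullet> v)))"
proof -
  obtain k s where k: "p = k + s" "T k = 0" "p \<bullet> s = 0"
  proof -
    have "p \<in> {u + v | u v. T u = 0 \<and> p \<bullet> v = 0}" unfolding tr by simp
    then show ?thesis using that by blast
  qed
  have pk: "p \<bullet> k = p \<bullet> p" using k(1,3) inner_add_right[of p k s] by simp
  have pp: "p \<bullet> p \<noteq> 0" using p by simp
  have "\<exists>v. (T v, 2 * (p \<bullet> v)) = (a, b)" for a b
  proof -
    obtain u where u: "T u = a" using sur by (metis surjD)
    define c where "c = (b / 2 - p \<bullet> u) / (p \<bullet> p)"
    have "T (u + c *\<^sub>R k) = a" using u k(2) by (simp add: linear_add[OF T] linear_scale[OF T])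
    moreover have "2 * (p \<bullet> (u + c *\<^sub>R k)) = b"
      using pp by (simp add: inner_add_right pk c_def)
    ultimately show ?thesis by (intro exI[of _ "u + c *\<^sub>R k"]) simp
  qed
  then show ?thesis unfolding surj_def by (metis surj_pair)
qed

theorem theorem2p3:
  fixes f :: "complex ^ 'n \<Rightarrow> complex"
    and U :: "(complex ^ 'n) set"
    and w :: "complex ^ 'n"
    and r\<^sub>0 :: real
  assumes "CARD('n) \<ge> 2"
    and "mixed_function U f"
    and "f 0 = 0"
    and "mixed_critical f 0"
    and "hamm_le_condition U f"
    and "stable_milnor_radius U f r\<^sub>0"
    and "mixed_smooth_zero U f w"
    and "norm w < r\<^sub>0"
    and "transverse_to_sphere_at f w"
    and "real_dimension {z \<in> U. f z = 0} = 2 * CARD('n) - 2"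
  shows "\<forall>r\<^sub>1 d r \<delta>. 0 < r\<^sub>1 \<and> r\<^sub>1 \<le> r \<and> r \<le> r\<^sub>0 \<and> hamm_le_bound f r\<^sub>0 r\<^sub>1 d \<and> 0 < \<delta> \<and> \<delta> \<le> d
           \<longrightarrow> connected (milnor_fiber f r \<delta>)"
proof (intro allI impI; elim conjE)
  fix r\<^sub>1 d r \<delta> :: real
  assume r: "0 < r\<^sub>1" "r\<^sub>1 \<le> r" "r \<le> r\<^sub>0" and bound: "hamm_le_bound f r\<^sub>0 r\<^sub>1 d" and \<delta>: "0 < \<delta>" "\<delta> \<le> d"
  have U: "open U" "0 \<in> U" using assms(2) by (auto simp: mixed_function_def)
  have r0: "0 < r\<^sub>0" "cball 0 r\<^sub>0 \<subseteq> U" using assms(6) by (auto simp: stable_milnor_radius_def)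
  obtain \<Omega> F where \<Omega>: "open \<Omega>" "with_conjugate ` U \<subseteq> \<Omega>" "normal_cpoly_sum_on \<Omega> F"
    and fF: "\<And>z. z \<in> U \<Longrightarrow> f z = F (with_conjugate z)"
    using mixed_function_lift[OF assms(2)] by metis
  obtain D where D: "has_C1_derivative_on (\<lambda>z. F (with_conjugate z)) D U"
    using normal_cpoly_sum_on_C1[OF \<Omega>(1,3) bounded_linear_with_conjugate \<Omega>(2)] by blast
  have df: "(f has_derivative blinfun_apply (D z)) (at z)" if "z \<in> U" for z
    by (rule has_derivative_transform_within_open[of "\<lambda>z. F (with_conjugate z)" _ z UNIV U])
       (use D fF U that in \<open>auto simp: has_C1_derivative_on_def\<close>)
  have C1: "has_C1_derivative_on f D U" using D df by (simp add: has_C1_derivative_on_def)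
  interpret C1_on_ball f D U r\<^sub>0 by (rule C1_on_ball.intro[OF U(1) r0(2) C1])
  have fD: "frechet_derivative f (at z) = blinfun_apply (D z)" if "z \<in> U" for z
    using frechet_derivative_at[OF df[OF that]] by simp
  have crit: "regular z \<longleftrightarrow> \<not> mixed_critical f z" if "z \<in> U" for z
    by (simp add: regular_def mixed_critical_def fD[OF that])
  have trans: "transverse z" if "z \<in> U" "z \<noteq> 0" "regular z" "transverse_to_sphere_at f z" for z
    unfolding transverse_def
    using that(3,4) unfolding regular_def transverse_to_sphere_at_def fiber_tangent_def sphere_tangent_def fD[OF that(1)]
    by (intro surj_with_radial_part[OF _ linear_blinfun that(2)]) simp_all
  have mreg: "milnor_regular \<rho> e" if "hamm_le_bound f r\<^sub>0 \<rho> e" "0 < \<rho>" "\<rho> \<le> r\<^sub>0" for \<rho> e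
    unfolding milnor_regular_def
  proof (intro ballI impI)
    fix p assume p: "p \<in> cball 0 r\<^sub>0" "f p \<in> punctured_cball e"
    have pU: "p \<in> U" using p r0 by auto
    have ne: "f p \<noteq> 0" "cmod (f p) \<le> e" using p(2) by (auto simp: punctured_cball_def)
    have b: "\<rho> \<le> s \<Longrightarrow> s \<le> r\<^sub>0 \<Longrightarrow> \<not> mixed_critical f p \<and> (norm p = s \<longrightarrow> transverse_to_sphere_at f p)" for s
      using that(1) ne p(1) unfolding hamm_le_bound_def by auto
    have "regular p" using b[OF order_refl that(3)] crit[OF pU] by blast
    moreover have "transverse p" if np: "\<rho> \<le> norm p"
    proof (rule trans[OF pU _ \<open>regular p\<close>])
      show "p \<noteq> 0" using np \<open>0 < \<rho>\<close> by auto
      show "transverse_to_sphere_at f p" using b[OF np] p(1) by simp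
    qed
    ultimately show "regular p \<and> (\<rho> \<le> norm p \<longrightarrow> transverse p)" by blast
  qed
  have d: "0 < d" using \<delta> by simp
  have reg1: "milnor_regular r\<^sub>1 d" by (rule mreg[OF bound]) (use r in auto)
  \<comment> \<open>For the tube only the boundary sphere of radius \<open>r\<^sub>0\<close>
    matters.\<close>
  then have regd: "milnor_regular r\<^sub>0 d" unfolding milnor_regular_def using r by auto
  have tube_con: "connected (tube e)" if e: "0 < e" "e \<le> d" for e
  proof -
    have "continuous (at 0) f" using df[OF U(2)] has_derivative_continuous by blast
    then obtain s where s: "s > 0" "\<And>z. dist z 0 < s \<Longrightarrow> dist (f z) (f 0) < e"
      using e(1) unfolding continuous_at_eps_delta by blast
    \<comment> \<open>Small enough that \<open>cmod (f z) < e\<close> on the ball, so that the ball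
      minus the zero set lies in the tube.\<close>
    define \<rho> where "\<rho> = min s r\<^sub>0"
    have \<rho>: "0 < \<rho>" "\<rho> \<le> r\<^sub>0" using s r0 by (auto simp: \<rho>_def)
    have ball: "ball 0 \<rho> \<subseteq> U" using \<rho>(2) r0(2) by (meson ball_subset_cball order_trans subset_ball subset_cball)
    \<comment> \<open>The given bound controls spheres of radius at least \<open>r\<^sub>1\<close>.
      To force points of least norm into the ball of radius \<open>\<rho>\<close>, a bound for
      \<open>\<rho>\<close> itself is taken from the Hamm-Le condition.\<close>
    obtain d' where d': "hamm_le_bound f r\<^sub>0 \<rho> d'" using assms(6) \<rho> unfolding stable_milnor_radius_def by blast
    have con: "connected (ball 0 \<rho> - {z. F (with_conjugate z) = 0})"
    proof (rule connected_complement_analytic_zeros[OF \<Omega>(1,3) bounded_linear_with_conjugate])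
      show "with_conjugate ` ball 0 \<rho> \<subseteq> \<Omega>" using \<Omega>(2) ball by blast
      fix k :: nat and M :: "(complex ^ 'n) set"
      assume M: "M \<noteq> {}" "M \<subseteq> {z \<in> ball 0 \<rho>. F (with_conjugate z) = 0}" "C1_submanifold k M"
      have "M \<subseteq> {z \<in> U. f z = 0}"
      proof
        fix z assume "z \<in> M"
        then have z: "z \<in> ball 0 \<rho>" "F (with_conjugate z) = 0" using M(2) by blast+
        have "z \<in> U" by (rule subsetD[OF ball z(1)])
        then show "z \<in> {z \<in> U. f z = 0}" using fF[of z] z(2) by simp
      qed
      from submanifold_dim_le_real_dimension[OF M(1) this M(3)]
      \<comment> \<open>The ambient real dimension is \<open>2 * CARD('n)\<close>, so the zero set
        is at least one dimension short of a hypersurface.\<close>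
      show "k < DIM(complex ^ 'n) - 1" using assms(1,10) by simp
    qed auto
    have "ball 0 \<rho> - {z. F (with_conjugate z) = 0} = ball 0 \<rho> - {z. f z = 0}"
    proof -
      have "F (with_conjugate z) = f z" if "z \<in> ball 0 \<rho>" for z
        using fF[OF subsetD[OF ball that]] by (rule sym)
      then have "{z \<in> ball 0 \<rho>. F (with_conjugate z) \<noteq> 0} = {z \<in> ball 0 \<rho>. f z \<noteq> 0}"
        by (intro Collect_cong conj_cong refl) simp
      then show ?thesis by (simp only: set_diff_eq mem_Collect_eq)
    qed
    with con have con: "connected (ball 0 \<rho> - {z. f z = 0})" by simp
    show ?thesis
    proof (rule connected_tube[OF milnor_regular_mono[OF regd e(2)] mreg[OF d' \<rho>] r0(1) e(1) _ \<rho>(2) _ con])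
      show "0 < d'" using d' by (simp add: hamm_le_bound_def)
      show "cmod (f z) \<le> e" if "z \<in> ball 0 \<rho>" for z
        using s(2)[of z] that assms(3) by (simp add: \<rho>_def dist_norm)
    qed
  qed
  have "w \<in> U" "f w = 0" "regular w" using assms(7) crit by (auto simp: mixed_smooth_zero_def)
  then obtain e where e: "0 < e" "e \<le> d" "\<And>\<eta>. \<eta> \<in> punctured_cball e \<Longrightarrow> connected (ball_fiber f (\<eta>, r\<^sub>0))"
    using connected_small_fibers[OF assms(8) _ _ r0(1) d] milnor_regular_mono[OF regd] tube_con by metis
  \<comment> \<open>One connected fibre in the largest ball is enough: value and radius then move
    together to \<open>\<delta>\<close> and \<open>r\<close> inside the regular range.\<close>
  have "connected (ball_fiber f (complex_of_real e, r\<^sub>0))"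
    by (rule e(3)) (use e in \<open>simp add: punctured_cball_def\<close>)
  then have "connected (ball_fiber f (complex_of_real \<delta>, r))"
    by (rule milnor_fibers_connected_if_one[OF reg1 r(1), rotated])
       (use e \<delta> r in \<open>auto simp: punctured_cball_def\<close>)
  then show "connected (milnor_fiber f r \<delta>)" by (simp add: ball_fiber_def milnor_fiber_def)
qed

end
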